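(* Let $(\Omega,\mu)$ be a measure space with $\mu$ continuous and $\mu\Omega<\infty$. Let $X$ be a real reflexive Banach lattice of measurable functions on $\Omega$ such that $L^\infty(\mu)\subset X\subset L^1(\mu)$ and $X^*=\{h:\ hf\in L^1(\mu)\ \forall f\in X\}$ with the duality $(f,h)=\int_\Omega fh\,d\mu$. Let $U=(u_k)_{k\ge1}$ be a normalized unconditional basis in $X$. Then for every $E\subset\Omega$ with $\mu E>0$, $$\Big(\int_E u_k^+\,d\mu\Big)_{k\ge1}\notin(\mathrm{Coef}(U))^*\quad\text{and}\quad\Big(\int_E u_k^-\,d\mu\Big)_{k\ge1}\notin(\mathrm{Coef}(U))^*.$$
   Context: Let $U'=(u_k')_{k\ge1}$ be the dual (biorthogonal) system, $(u_k,u_j')=\delta_{kj}$, so that $f=\sum_{k\ge1}(f,u_k')u_k$ for every $f\in X$. $\mathrm{Coef}(U)=\{((f,u_k'))_{k\ge1}:\ f\in X\}$ is the sequence space of coefficients (normed by the norm of the corresponding $f$), and $(\mathrm{Coef}(U))^*$ is its dual with respect to the duality $(a,b)=\sum_{k\ge1}a_kb_k$ (it equals $\mathrm{Coef}(U')$). For a real function $u$, $u^{\pm}=\max(0,\pm u)$. *)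

theory Defs
  imports "HOL-Probability.Probability"
begin

definition atomless :: "'a measure \<Rightarrow> bool" where
  "atomless M \<longleftrightarrow>
     (\<forall>A\<in>sets M. 0 < measure M A \<longrightarrow>
        (\<exists>B\<in>sets M. B \<subseteq> A \<and> 0 < measure M B \<and> measure M B < measure M A))"

definition banach_lattice_fs :: "'a measure \<Rightarrow> ('a \<Rightarrow> real) set \<Rightarrow> (('a \<Rightarrow> real) \<Rightarrow> real) \<Rightarrow> bool" where
  "banach_lattice_fs M X N \<longleftrightarrow>
     X \<subseteq> borel_measurable M \<and>
     (\<forall>f\<in>X. \<forall>g\<in>borel_measurable M. (AE x in M. f x = g x) \<longrightarrow> g \<in> X \<and> N g = N f) \<and>
     (\<lambda>x. 0) \<in> X \<and>
     (\<forall>f\<in>X. \<forall>g\<in>X. (\<lambda>x. f x + g x) \<in> X) \<and>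
     (\<forall>f\<in>X. \<forall>c::real. (\<lambda>x. c * f x) \<in> X) \<and>
     (\<forall>f\<in>X. 0 \<le> N f) \<and>
     (\<forall>f\<in>X. N f = 0 \<longleftrightarrow> (AE x in M. f x = 0)) \<and>
     (\<forall>f\<in>X. \<forall>g\<in>X. N (\<lambda>x. f x + g x) \<le> N f + N g) \<and>
     (\<forall>f\<in>X. \<forall>c::real. N (\<lambda>x. c * f x) = \<bar>c\<bar> * N f) \<and>
     (\<forall>f\<in>X. (\<lambda>x. \<bar>f x\<bar>) \<in> X) \<and>
     (\<forall>f\<in>X. \<forall>g\<in>X. (AE x in M. \<bar>f x\<bar> \<le> \<bar>g x\<bar>) \<longrightarrow> N f \<le> N g) \<and>
     (\<forall>s. (\<forall>n. s n \<in> X) \<and>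
          (\<forall>e>0. \<exists>K. \<forall>m\<ge>K. \<forall>n\<ge>K. N (\<lambda>x. s m x - s n x) < e) \<longrightarrow>
          (\<exists>f\<in>X. (\<lambda>n. N (\<lambda>x. s n x - f x)) \<longlonglongrightarrow> 0))"

text \<open>Bounded linear functionals on X (only their values on X matter).\<close>
definition bdd_lin_fun :: "('a \<Rightarrow> real) set \<Rightarrow> (('a \<Rightarrow> real) \<Rightarrow> real) \<Rightarrow> (('a \<Rightarrow> real) \<Rightarrow> real) \<Rightarrow> bool" where
  "bdd_lin_fun X N \<phi> \<longleftrightarrow>
     (\<forall>f\<in>X. \<forall>g\<in>X. \<forall>a b::real. \<phi> (\<lambda>x. a * f x + b * g x) = a * \<phi> f + b * \<phi> g) \<and>
     (\<exists>C. \<forall>f\<in>X. \<bar>\<phi> f\<bar> \<le> C * N f)"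

definition dual_norm :: "('a \<Rightarrow> real) set \<Rightarrow> (('a \<Rightarrow> real) \<Rightarrow> real) \<Rightarrow> (('a \<Rightarrow> real) \<Rightarrow> real) \<Rightarrow> real" where
  "dual_norm X N \<phi> = Sup {\<bar>\<phi> f\<bar> | f. f \<in> X \<and> N f \<le> 1}"

definition reflexive_fs :: "('a \<Rightarrow> real) set \<Rightarrow> (('a \<Rightarrow> real) \<Rightarrow> real) \<Rightarrow> bool" where
  "reflexive_fs X N \<longleftrightarrow>
     (\<forall>\<Phi> :: (('a \<Rightarrow> real) \<Rightarrow> real) \<Rightarrow> real.
        ((\<forall>\<phi> \<psi> a b. bdd_lin_fun X N \<phi> \<longrightarrow> bdd_lin_fun X N \<psi> \<longrightarrow>
            \<Phi> (\<lambda>f. a * \<phi> f + b * \<psi> f) = a * \<Phi> \<phi> + b * \<Phi> \<psi>) \<and>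
         (\<exists>C. \<forall>\<phi>. bdd_lin_fun X N \<phi> \<longrightarrow> \<bar>\<Phi> \<phi>\<bar> \<le> C * dual_norm X N \<phi>))
        \<longrightarrow> (\<exists>f\<in>X. \<forall>\<phi>. bdd_lin_fun X N \<phi> \<longrightarrow> \<Phi> \<phi> = \<phi> f))"

definition koethe_dual_is_dual :: "'a measure \<Rightarrow> ('a \<Rightarrow> real) set \<Rightarrow> (('a \<Rightarrow> real) \<Rightarrow> real) \<Rightarrow> bool" where
  "koethe_dual_is_dual M X N \<longleftrightarrow>
     (\<forall>\<phi>. bdd_lin_fun X N \<phi> \<longrightarrow>
        (\<exists>h\<in>borel_measurable M. (\<forall>f\<in>X. integrable M (\<lambda>x. f x * h x)) \<and>
                                 (\<forall>f\<in>X. \<phi> f = (\<integral>x. f x * h x \<partial>M)))) \<and>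
     (\<forall>h\<in>borel_measurable M. (\<forall>f\<in>X. integrable M (\<lambda>x. f x * h x)) \<longrightarrow>
        bdd_lin_fun X N (\<lambda>f. \<integral>x. f x * h x \<partial>M))"

text \<open>Schauder basis (indexed from 0 instead of 1).\<close>
definition schauder_basis :: "('a \<Rightarrow> real) set \<Rightarrow> (('a \<Rightarrow> real) \<Rightarrow> real) \<Rightarrow> (nat \<Rightarrow> 'a \<Rightarrow> real) \<Rightarrow> bool" where
  "schauder_basis X N u \<longleftrightarrow>
     (\<forall>k. u k \<in> X) \<and>
     (\<forall>f\<in>X. \<exists>!c::nat \<Rightarrow> real. (\<lambda>n. N (\<lambda>x. f x - (\<Sum>k<n. c k * u k x))) \<longlonglongrightarrow> 0)"

definition basis_coef :: "('a \<Rightarrow> real) set \<Rightarrow> (('a \<Rightarrow> real) \<Rightarrow> real) \<Rightarrow> (nat \<Rightarrow> 'a \<Rightarrow> real) \<Rightarrow> ('a \<Rightarrow> real) \<Rightarrow> nat \<Rightarrow> real" where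
  "basis_coef X N u f = (THE c. (\<lambda>n. N (\<lambda>x. f x - (\<Sum>k<n. c k * u k x))) \<longlonglongrightarrow> 0)"

definition unconditional_basis :: "('a \<Rightarrow> real) set \<Rightarrow> (('a \<Rightarrow> real) \<Rightarrow> real) \<Rightarrow> (nat \<Rightarrow> 'a \<Rightarrow> real) \<Rightarrow> bool" where
  "unconditional_basis X N u \<longleftrightarrow>
     schauder_basis X N u \<and>
     (\<forall>f\<in>X. \<forall>\<sigma>::nat \<Rightarrow> nat. bij \<sigma> \<longrightarrow>
        (\<lambda>n. N (\<lambda>x. f x - (\<Sum>k<n. basis_coef X N u f (\<sigma> k) * u (\<sigma> k) x))) \<longlonglongrightarrow> 0)"

text \<open>(Coef(U))^*: sequences b such that a \<mapsto> \<Sum> a_k b_k is a well-defined bounded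
  functional on Coef(U) (normed by the norm of the corresponding f).\<close>
definition coef_dual :: "('a \<Rightarrow> real) set \<Rightarrow> (('a \<Rightarrow> real) \<Rightarrow> real) \<Rightarrow> (nat \<Rightarrow> 'a \<Rightarrow> real) \<Rightarrow> (nat \<Rightarrow> real) set" where
  "coef_dual X N u =
     {b. (\<forall>f\<in>X. summable (\<lambda>k. basis_coef X N u f k * b k)) \<and>
         (\<exists>C. \<forall>f\<in>X. \<bar>\<Sum>k. basis_coef X N u f k * b k\<bar> \<le> C * N f)}"

end

theory Submission
  imports Defs
begin

text \<open>Write \<open>b\<^sub>k = \<integral>\<^sub>E \<bar>u\<^sub>k\<bar>\<close>. Since \<open>\<bar>u\<bar> = 2 u\<^sup>+ - u = 2 u\<^sup>- + u\<close> and \<open>(\<integral>\<^sub>E u\<^sub>k)\<close> always lies in the dual of the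
  coefficient space, either of the two memberships makes \<open>b\<close> a bounded functional on
  coefficients. By unconditionality \<open>f \<mapsto> (a\<^sub>k(f) b\<^sub>k)\<close> is then a bounded operator from \<open>X\<close> to
  \<open>\<ell>\<^sup>1\<close>, and \<open>\<integral>\<^sub>E \<bar>f\<bar> \<le> \<Sum> \<bar>a\<^sub>k(f)\<bar> b\<^sub>k\<close>. On an atomless space \<open>E\<close> carries a Rademacher-like sequence
  \<open>r\<^sub>n\<close> with \<open>\<bar>r\<^sub>n\<bar> = 1\<close> on \<open>E\<close>; it is orthogonal, hence weakly null in \<open>X\<close>, because functionals on \<open>X\<close> are
  given by functions in \<open>L\<^sup>1\<close>. Its image in \<open>\<ell>\<^sup>1\<close> is weakly null and so, by the Schur property, null in norm,
  which contradicts \<open>\<integral>\<^sub>E \<bar>r\<^sub>n\<bar> = \<mu>(E) > 0\<close>.\<close>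

section \<open>Complete spaces of functions\<close>

text \<open>\<open>N\<close> is only a seminorm here, since functions that agree almost everywhere
  are different elements of \<open>X\<close>. Limits are therefore not unique as functions;
  uniqueness of expansions comes from the basis property instead. No measure or order is mentioned,
  so the category argument and the theory of bases are purely linear.\<close>

locale complete_fun_space =
  fixes X :: "('a \<Rightarrow> real) set" and N :: "('a \<Rightarrow> real) \<Rightarrow> real"
  assumes zero [simp, intro]: "(\<lambda>x. 0) \<in> X"
    and add: "\<And>f g. f \<in> X \<Longrightarrow> g \<in> X \<Longrightarrow> (\<lambda>x. f x + g x) \<in> X"
    and scale: "\<And>f c. f \<in> X \<Longrightarrow> (\<lambda>x. c * f x) \<in> X"
    and N_nonneg: "\<And>f. f \<in> X \<Longrightarrow> 0 \<le> N f"
    and N_add: "\<And>f g. f \<in> X \<Longrightarrow> g \<in> X \<Longrightarrow> N (\<lambda>x. f x + g x) \<le> N f + N g"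
    and N_scale: "\<And>f c. f \<in> X \<Longrightarrow> N (\<lambda>x. c * f x) = \<bar>c\<bar> * N f"
    and N_complete: "\<And>s. (\<And>n. s n \<in> X) \<Longrightarrow>
      (\<And>e. 0 < e \<Longrightarrow> \<exists>K. \<forall>m\<ge>K. \<forall>n\<ge>K. N (\<lambda>x. s m x - s n x) < e) \<Longrightarrow>
      \<exists>f\<in>X. (\<lambda>n. N (\<lambda>x. s n x - f x)) \<longlonglongrightarrow> 0"
begin

lemma N_zero [simp]: "N (\<lambda>x. 0) = 0"
  using N_scale[OF zero, of 0] by simp

lemma diff: "f \<in> X \<Longrightarrow> g \<in> X \<Longrightarrow> (\<lambda>x. f x - g x) \<in> X"
  using add[of f "\<lambda>x. -1 * g x"] scale[of g "-1"] by simp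

lemma sum_mem: "(\<And>i. i \<in> F \<Longrightarrow> g i \<in> X) \<Longrightarrow> (\<lambda>x. \<Sum>i\<in>F. g i x) \<in> X"
  by (induction F rule: infinite_finite_induct) (auto intro: add)

lemma N_minus_commute: "f \<in> X \<Longrightarrow> g \<in> X \<Longrightarrow> N (\<lambda>x. f x - g x) = N (\<lambda>x. g x - f x)"
  using N_scale[OF diff[of f g], of "-1"] by simp

lemma N_diff_le: "f \<in> X \<Longrightarrow> g \<in> X \<Longrightarrow> N (\<lambda>x. f x - g x) \<le> N f + N g"
  using N_add[of f "\<lambda>x. -1 * g x"] scale[of g "-1"] N_scale[of g "-1"] by simp

lemma N_triangle:
  assumes "f \<in> X" "g \<in> X" "h \<in> X"
  shows "N (\<lambda>x. f x - h x) \<le> N (\<lambda>x. f x - g x) + N (\<lambda>x. g x - h x)"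
  using N_add[OF diff[OF assms(1,2)] diff[OF assms(2,3)]] by simp

lemma N_le_diff: "f \<in> X \<Longrightarrow> g \<in> X \<Longrightarrow> N f \<le> N (\<lambda>x. f x - g x) + N g"
  using N_add[OF diff, of f g g] by simp

lemma N_sum: "(\<And>i. i \<in> F \<Longrightarrow> g i \<in> X) \<Longrightarrow> N (\<lambda>x. \<Sum>i\<in>F. g i x) \<le> (\<Sum>i\<in>F. N (g i))"
proof (induction F rule: infinite_finite_induct)
  case (insert j F)
  have "N (\<lambda>x. g j x + (\<Sum>i\<in>F. g i x)) \<le> N (g j) + N (\<lambda>x. \<Sum>i\<in>F. g i x)"
    using insert by (intro N_add sum_mem) auto
  then show ?case using insert by auto
qed auto

text \<open>Baire category argument by nested balls, for a \<open>p\<close> with finite values.\<close>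
lemma sublevel_dense_in_ball:
  fixes p :: "('a \<Rightarrow> real) \<Rightarrow> real"
  obtains n :: nat and w r where "w \<in> X" "0 < r"
    "\<And>y e. y \<in> X \<Longrightarrow> N (\<lambda>x. y x - w x) < r \<Longrightarrow> 0 < e \<Longrightarrow>
      \<exists>z\<in>X. p z \<le> real n \<and> N (\<lambda>x. y x - z x) < e"
proof -
  have "\<exists>n::nat. \<exists>w\<in>X. \<exists>r>0. \<forall>y\<in>X. \<forall>e>0. N (\<lambda>x. y x - w x) < r \<longrightarrow>
      (\<exists>z\<in>X. p z \<le> real n \<and> N (\<lambda>x. y x - z x) < e)"
  proof (rule ccontr)
    assume "\<not> ?thesis"
    then have neg: "\<exists>y\<in>X. \<exists>e>0. N (\<lambda>x. y x - w x) < r \<and>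
        (\<forall>z\<in>X. N (\<lambda>x. y x - z x) < e \<longrightarrow> real n < p z)" if "w \<in> X" "0 < r" for n :: nat and w r
      using that by (metis not_le)
    \<comment> \<open>A pair \<open>q\<close> encodes a ball, centre first and radius second, on
      which \<open>p\<close> exceeds \<open>n\<close> throughout.\<close>
    define Q where "Q = (\<lambda>(n::nat) (q::('a \<Rightarrow> real) \<times> real). fst q \<in> X \<and> 0 < snd q \<and>
        (\<forall>z\<in>X. N (\<lambda>x. fst q x - z x) < snd q \<longrightarrow> real n < p z))"
    have base: "\<exists>q. Q 0 q"
      using neg[OF zero, of 1 0] by (force simp: Q_def)
    have step: "\<exists>q'. Q (Suc n) q' \<and>
        (N (\<lambda>x. fst q' x - fst q x) < snd q / 4 \<and> snd q' \<le> snd q / 2)" if "Q n q" for n q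
    proof -
      from that have "fst q \<in> X" "0 < snd q / 4" by (auto simp: Q_def)
      from neg[OF this, of "Suc n"] obtain y e where "y \<in> X" "0 < e" "N (\<lambda>x. y x - fst q x) < snd q / 4"
        "\<forall>z\<in>X. N (\<lambda>x. y x - z x) < e \<longrightarrow> real (Suc n) < p z" by blast
      then show ?thesis using that
        by (intro exI[of _ "(y, min e (snd q / 2))"]) (auto simp: Q_def)
    qed
    obtain q where q: "\<And>n. Q n (q n)"
      "\<And>n. N (\<lambda>x. fst (q (Suc n)) x - fst (q n) x) < snd (q n) / 4 \<and> snd (q (Suc n)) \<le> snd (q n) / 2"
      using dependent_nat_choice[of Q "\<lambda>_ q q'. N (\<lambda>x. fst q' x - fst q x) < snd q / 4 \<and> snd q' \<le> snd q / 2"]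
        base step by blast
    define y where "y = (\<lambda>n. fst (q n))"
    define e where "e = (\<lambda>n. snd (q n))"
    have y: "y n \<in> X" and e: "0 < e n" and far: "\<And>z. z \<in> X \<Longrightarrow> N (\<lambda>x. y n x - z x) < e n \<Longrightarrow> real n < p z"
      and y_step: "N (\<lambda>x. y (Suc n) x - y n x) < e n / 4" and e_step: "e (Suc n) \<le> e n / 2" for n
      using q(1)[of n] q(2)[of n] by (auto simp: Q_def y_def e_def)
    \<comment> \<open>One move of the centre is below \<open>e n / 4\<close>, which is at most
      \<open>e n / 2 - e (Suc n) / 2\<close> because the radii at least halve, so the moves
      telescope. In the limit the distance from \<open>y n\<close> stays strictly below
      \<open>e n\<close>, and the limit point belongs to every ball.\<close>
    have close: "N (\<lambda>x. y (n + j) x - y n x) \<le> e n / 2 - e (n + j) / 2" for n j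
    proof (induction j)
      case (Suc j)
      have "N (\<lambda>x. y (n + Suc j) x - y n x) \<le> N (\<lambda>x. y (Suc (n+j)) x - y (n+j) x) + N (\<lambda>x. y (n + j) x - y n x)"
        using N_triangle[OF y y y, of "Suc (n+j)" n "n+j"] by simp
      then show ?case using Suc y_step[of "n+j"] e_step[of "n+j"] e[of "n+j"] by simp
    qed simp
    have e_le: "e n \<le> e 0 * (1/2)^n" for n
    proof (induction n)
      case (Suc n)
      then show ?case using e_step[of n] by simp
    qed simp
    have "(\<lambda>n. e 0 * (1/2)^n) \<longlonglongrightarrow> e 0 * 0"
      by (intro tendsto_mult tendsto_const LIMSEQ_power_zero) simp
    then have e_lim: "e \<longlonglongrightarrow> 0"
      using e by (intro tendsto_sandwich[of "\<lambda>_. 0" e _ "\<lambda>n. e 0 * (1/2)^n"])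
        (auto intro!: always_eventually e_le simp: less_imp_le)
    have "\<exists>f\<in>X. (\<lambda>n. N (\<lambda>x. y n x - f x)) \<longlonglongrightarrow> 0"
    proof (rule N_complete[OF y])
      fix d :: real assume "0 < d"
      then obtain K where K: "e K < d"
        using order_tendstoD(2)[OF e_lim] by (metis eventually_sequentially order_refl)
      have "N (\<lambda>x. y m x - y n x) < d" if "m \<ge> K" "n \<ge> K" for m n
      proof -
        have "N (\<lambda>x. y m x - y n x) \<le> N (\<lambda>x. y m x - y K x) + N (\<lambda>x. y n x - y K x)"
          using N_triangle[OF y y y, of m n K] N_minus_commute[OF y y, of n K] by simp
        also have "\<dots> < d"
          using close[of K "m-K"] close[of K "n-K"] that K e[of m] e[of n] by auto
        finally show ?thesis .
      qed
      then show "\<exists>K. \<forall>m\<ge>K. \<forall>n\<ge>K. N (\<lambda>x. y m x - y n x) < d" by blast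
    qed
    then obtain f where f: "f \<in> X" "(\<lambda>n. N (\<lambda>x. y n x - f x)) \<longlonglongrightarrow> 0" by blast
    have "N (\<lambda>x. y n x - f x) < e n" for n
    proof -
      have "\<forall>\<^sub>F m in sequentially. N (\<lambda>x. y m x - f x) < e n / 2"
        using order_tendstoD(2)[OF f(2), of "e n / 2"] e[of n] by simp
      then have "\<forall>\<^sub>F m in sequentially. n \<le> m \<and> N (\<lambda>x. y m x - f x) < e n / 2"
        by (intro eventually_conj eventually_ge_at_top)
      then obtain m where m: "m \<ge> n" "N (\<lambda>x. y m x - f x) < e n / 2"
        using eventually_happens'[OF sequentially_bot] by blast
      have "N (\<lambda>x. y n x - y m x) \<le> e n / 2 - e m / 2"
        using close[of n "m-n"] N_minus_commute[OF y y, of n m] m(1) by simp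
      then show ?thesis
        using N_triangle[OF y y f(1), of n m] m(2) e[of m] by linarith
    qed
    then have "real n < p f" for n using far f by blast
    then show False using reals_Archimedean2[of "p f"] by (meson less_asym)
  qed
  then show ?thesis using that by blast
qed

text \<open>Zabreiko's lemma. Approximation within a sublevel set is iterated: each \<open>y\<close> is the sum of a series whose
  values under \<open>p\<close> decrease geometrically.\<close>
lemma countably_subadditive_bounded:
  fixes p :: "('a \<Rightarrow> real) \<Rightarrow> real"
  assumes p_nonneg: "\<And>f. f \<in> X \<Longrightarrow> 0 \<le> p f"
    and p_scale: "\<And>f c. f \<in> X \<Longrightarrow> p (\<lambda>x. c * f x) = \<bar>c\<bar> * p f"
    and p_add: "\<And>f g. f \<in> X \<Longrightarrow> g \<in> X \<Longrightarrow> p (\<lambda>x. f x + g x) \<le> p f + p g"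
    and p_suminf: "\<And>z f. (\<And>i. z i \<in> X) \<Longrightarrow> f \<in> X \<Longrightarrow> summable (\<lambda>i. p (z i)) \<Longrightarrow>
      (\<lambda>n. N (\<lambda>x. f x - (\<Sum>i<n. z i x))) \<longlonglongrightarrow> 0 \<Longrightarrow> p f \<le> (\<Sum>i. p (z i))"
  obtains K where "\<And>f. f \<in> X \<Longrightarrow> p f \<le> K * N f"
proof -
  obtain n w r where w: "w \<in> X" and r: "0 < r" and dense:
    "\<And>y e. y \<in> X \<Longrightarrow> N (\<lambda>x. y x - w x) < r \<Longrightarrow> 0 < e \<Longrightarrow>
      \<exists>z\<in>X. p z \<le> real n \<and> N (\<lambda>x. y x - z x) < e"
    by (rule sublevel_dense_in_ball[of p]) blast
  \<comment> \<open>The dense ball is moved to the origin: approximate \<open>y + w\<close> and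
    \<open>w\<close> and subtract. Symmetry and subadditivity of \<open>p\<close> double the
    level.\<close>
  have dense0: "\<exists>z\<in>X. p z \<le> 2 * real n \<and> N (\<lambda>x. y x - z x) < e"
    if y: "y \<in> X" "N y < r" "0 < e" for y e
  proof -
    obtain z1 where z1: "z1 \<in> X" "p z1 \<le> real n" "N (\<lambda>x. (y x + w x) - z1 x) < e/2"
      using dense[OF add[OF y(1) w], of "e/2"] y by auto
    obtain z2 where z2: "z2 \<in> X" "p z2 \<le> real n" "N (\<lambda>x. w x - z2 x) < e/2"
      using dense[OF w, of "e/2"] y r by auto
    have "p (\<lambda>x. z1 x - z2 x) \<le> 2 * real n"
      using p_add[OF z1(1) scale[OF z2(1), of "-1"]] p_scale[OF z2(1), of "-1"] z1 z2 by simp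
    moreover have "N (\<lambda>x. y x - (z1 x - z2 x)) < e"
      using N_diff_le[OF diff[OF add[OF y(1) w] z1(1)] diff[OF w z2(1)]] z1 z2
      by (simp add: algebra_simps)
    ultimately show ?thesis using diff[OF z1(1) z2(1)] by blast
  qed
  \<comment> \<open>Scaling \<open>y\<close> to norm \<open>r / 2\<close> and back multiplies by
    \<open>2 * N y / r\<close>, which turns the level \<open>2 * real n\<close> into
    \<open>L * N y\<close>.\<close>
  define L where "L = 4 * real n / r"
  have half: "\<exists>z\<in>X. p z \<le> L * N y \<and> N (\<lambda>x. y x - z x) \<le> N y / 2" if y: "y \<in> X" for y
  proof (cases "N y = 0")
    case True
    then show ?thesis using p_scale[OF zero, of 0] by (intro bexI[of _ "\<lambda>x. 0"]) auto
  next
    case False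
    then have pos: "0 < N y" using N_nonneg[OF y] by simp
    define c where "c = r / (2 * N y)"
    have c: "0 < c" using pos r by (simp add: c_def)
    have "N (\<lambda>x. c * y x) < r" using N_scale[OF y, of c] pos r by (simp add: c_def)
    then obtain z where z: "z \<in> X" "p z \<le> 2 * real n" "N (\<lambda>x. c * y x - z x) < c * N y / 2"
      using dense0[OF scale[OF y], of c "c * N y / 2"] c pos by auto
    have "p (\<lambda>x. (1/c) * z x) \<le> L * N y"
      using p_scale[OF z(1), of "1/c"] z(2) pos r c by (simp add: c_def L_def field_simps)
    moreover have "(\<lambda>x. y x - (1/c) * z x) = (\<lambda>x. (1/c) * (c * y x - z x))"
      using c by (auto simp: field_simps)
    then have "N (\<lambda>x. y x - (1/c) * z x) = N (\<lambda>x. c * y x - z x) / c"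
      using N_scale[OF diff[OF scale[OF y] z(1)], of "1/c" c] c by simp
    then have "N (\<lambda>x. y x - (1/c) * z x) \<le> N y / 2"
      using z(3) c by (simp add: pos_divide_le_eq mult.commute)
    ultimately show ?thesis using scale[OF z(1)] by blast
  qed
  have "p y \<le> (2 * L) * N y" if y: "y \<in> X" for y
  proof -
    obtain s where s: "\<And>y. y \<in> X \<Longrightarrow> s y \<in> X \<and> p (s y) \<le> L * N y \<and> N (\<lambda>x. y x - s y x) \<le> N y / 2"
      using half by metis
    \<comment> \<open>\<open>v i\<close> is the remainder after \<open>i\<close> successive
      approximations. Its norm at least halves each time, so the subtracted pieces sum to
      \<open>y\<close> and their values under \<open>p\<close> total at most
      \<open>2 * L * N y\<close>.\<close>
    define v where "v = rec_nat y (\<lambda>_ f x. f x - s f x)"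
    have v0: "v 0 = y" and vS: "v (Suc i) = (\<lambda>x. v i x - s (v i) x)" for i
      by (simp_all add: v_def)
    have v: "v i \<in> X" for i by (induction i) (auto simp: v0 vS y s intro!: diff)
    have Nv: "N (v i) \<le> N y * (1/2)^i" for i
    proof (induction i)
      case (Suc i)
      then show ?case using s[OF v, of i] by (simp add: vS)
    qed (simp add: v0)
    have L: "0 \<le> L" using r by (simp add: L_def)
    have ps: "p (s (v i)) \<le> L * N y * (1/2)^i" for i
      using s[OF v, of i] mult_left_mono[OF Nv L, of i] by (simp add: mult.assoc)
    have sums: "(\<lambda>i. L * N y * (1/2)^i) sums (L * N y * (1 / (1 - 1/2)))"
      by (intro sums_mult geometric_sums) simp
    have summ: "summable (\<lambda>i. p (s (v i)))"
      using ps s[OF v] p_nonneg by (intro summable_comparison_test'[OF sums_summable[OF sums]]) auto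
    have rest: "(\<lambda>x. y x - (\<Sum>i<n. s (v i) x)) = v n" for n
    proof (induction n)
      case (Suc n)
      show ?case
      proof
        fix x show "y x - (\<Sum>i<Suc n. s (v i) x) = v (Suc n) x"
          using fun_cong[OF Suc, of x] by (simp add: vS)
      qed
    qed (simp add: v0)
    have "(\<lambda>i. N y * (1/2)^i) \<longlonglongrightarrow> N y * 0"
      by (intro tendsto_mult tendsto_const LIMSEQ_power_zero) simp
    then have "(\<lambda>i. N (v i)) \<longlonglongrightarrow> 0"
      using Nv by (intro Lim_null_comparison[of "\<lambda>i. N (v i)" "\<lambda>n. N y * (1/2)^n"] always_eventually)
        (simp_all add: N_nonneg[OF v])
    then have "(\<lambda>n. N (\<lambda>x. y x - (\<Sum>i<n. s (v i) x))) \<longlonglongrightarrow> 0"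
      unfolding rest .
    then have "p y \<le> (\<Sum>i. p (s (v i)))"
      by (rule p_suminf[of "\<lambda>i. s (v i)" y, OF conjunct1[OF s[OF v]] y summ])
    also have "\<dots> \<le> L * N y * (1 / (1 - 1/2))"
      using suminf_le[OF ps summ sums_summable[OF sums]] sums_unique[OF sums] by simp
    finally show ?thesis by simp
  qed
  then show ?thesis using that by blast
qed

end

lemma (in complete_fun_space) N_tendsto_zero:
  assumes "\<And>n. g n \<in> X" "\<And>n. N (g n) \<le> h n" "h \<longlonglongrightarrow> 0"
  shows "(\<lambda>n. N (g n)) \<longlonglongrightarrow> 0"
  using assms(3)
  by (rule Lim_null_comparison[OF always_eventually, rotated]) (simp add: assms N_nonneg)

section \<open>Unconditional convergence\<close>

text \<open>Listing the naturals by increasing key produces a permutation, and every sublevel set of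
  the key appears as an initial segment of the list. A rearrangement can thus be prescribed by
  writing down keys.\<close>

lemma ex_bij_sorting_key:
  fixes key :: "nat \<Rightarrow> nat"
  assumes "inj key"
  shows "\<exists>\<sigma>::nat \<Rightarrow> nat. bij \<sigma> \<and> (\<forall>t. \<exists>n. \<sigma> ` {..<n} = {k. key k < t})"
proof -
  define e where "e = enumerate (range key)"
  have inf: "infinite (range key)" using assms by (rule range_inj_infinite)
  then have e: "bij_betw e UNIV (range key)" and mono: "strict_mono e" and le: "i \<le> e i" for i
    by (auto simp: e_def bij_enumerate strict_mono_enumerate le_enumerate)
  define \<sigma> where "\<sigma> = inv key \<circ> e"
  have key_\<sigma>: "key (\<sigma> i) = e i" for i
    using bij_betwE[OF e] by (auto simp: \<sigma>_def intro: f_inv_into_f)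
  have "bij \<sigma>"
    unfolding \<sigma>_def using e assms by (intro bij_betw_trans[of e _ "range key"] bij_betw_inv_into inj_on_imp_bij_betw)
  moreover have "\<exists>n. \<sigma> ` {..<n} = {k. key k < t}" for t
  proof -
    define n where "n = (LEAST i. t \<le> e i)"
    have "t \<le> e n" unfolding n_def by (rule LeastI[of _ t]) (rule le)
    have lt: "e i < t \<longleftrightarrow> i < n" for i
      using not_less_Least[of i "\<lambda>i. t \<le> e i"] \<open>t \<le> e n\<close> strict_mono_less_eq[OF mono, of n i]
      by (auto simp: n_def[symmetric] not_le[symmetric])
    have "k \<in> \<sigma> ` {..<n}" if "key k < t" for k
    proof -
      obtain i where i: "k = \<sigma> i" using \<open>bij \<sigma>\<close> by (metis bij_pointE)
      then show ?thesis using that lt[of i] key_\<sigma>[of i] by auto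
    qed
    moreover have "key (\<sigma> i) < t" if "i < n" for i using that lt key_\<sigma> by simp
    ultimately have "\<sigma> ` {..<n} = {k. key k < t}" by auto
    then show ?thesis ..
  qed
  ultimately show ?thesis by (intro exI[of _ \<sigma>] conjI allI)
qed

text \<open>The blocks between consecutive values tile the naturals, because \<open>m\<close> starts
  at 0 and is unbounded. Both the rearrangement of a series and the gliding hump cut the indices in
  this way.\<close>

lemma strict_mono_block:
  fixes m :: "nat \<Rightarrow> nat"
  assumes "strict_mono m" "m 0 = 0"
  shows "\<exists>!j. m j \<le> k \<and> k < m (Suc j)"
proof (rule ex_ex1I)
  define i where "i = (LEAST i. k < m i)"
  have "k < m (Suc k)" using strict_mono_imp_increasing[OF assms(1), of "Suc k"] by simp
  then have i: "k < m i" unfolding i_def by (rule LeastI)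
  then obtain j where "i = Suc j" using assms(2) by (cases i) auto
  moreover have "\<not> k < m j" using not_less_Least[of j "\<lambda>i. k < m i"] \<open>i = Suc j\<close> by (simp add: i_def)
  ultimately show "\<exists>j. m j \<le> k \<and> k < m (Suc j)" using i by (auto simp: not_less)
next
  fix j j' assume *: "m j \<le> k \<and> k < m (Suc j)" "m j' \<le> k \<and> k < m (Suc j')"
  then have "m j < m (Suc j')" "m j' < m (Suc j)" by auto
  then show "j = j'" using strict_mono_less[OF assms(1)] by (simp add: less_Suc_eq_le)
qed

context complete_fun_space
begin

text \<open>Discarding the indices below \<open>m\<close> costs at most the fixed amount
  \<open>\<Sum>k<m. N (v k)\<close>, so a finite set whose sum exceeds this by more than 1 still has
  a large sum beyond \<open>m\<close>.\<close>

lemma far_block_of_unbounded_sums: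
  assumes v: "\<And>k. v k \<in> X" and unbdd: "\<nexists>B. \<forall>F. finite F \<longrightarrow> N (\<lambda>x. \<Sum>k\<in>F. v k x) \<le> B"
  shows "\<exists>F. finite F \<and> F \<subseteq> {m::nat..} \<and> 1 \<le> N (\<lambda>x. \<Sum>k\<in>F. v k x)"
proof -
  obtain F where F: "finite F" "1 + (\<Sum>k<m. N (v k)) < N (\<lambda>x. \<Sum>k\<in>F. v k x)"
    using unbdd by (metis not_le)
  have "N (\<lambda>x. \<Sum>k\<in>F. v k x) = N (\<lambda>x. (\<Sum>k\<in>F \<inter> {m..}. v k x) + (\<Sum>k\<in>F \<inter> {..<m}. v k x))"
    using F(1) by (subst sum.union_disjoint[symmetric]) (auto intro!: arg_cong[of _ _ N] sum.cong)
  also have "\<dots> \<le> N (\<lambda>x. \<Sum>k\<in>F \<inter> {m..}. v k x) + N (\<lambda>x. \<Sum>k\<in>F \<inter> {..<m}. v k x)"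
    by (intro N_add sum_mem v)
  also have "N (\<lambda>x. \<Sum>k\<in>F \<inter> {..<m}. v k x) \<le> (\<Sum>k\<in>F \<inter> {..<m}. N (v k))"
    by (intro N_sum v)
  also have "\<dots> \<le> (\<Sum>k<m. N (v k))"
    by (intro sum_mono2) (auto simp: N_nonneg v)
  finally have "1 \<le> N (\<lambda>x. \<Sum>k\<in>F \<inter> {m..}. v k x)" using F(2) by linarith
  then show ?thesis using F(1) by (intro exI[of _ "F \<inter> {m..}"]) auto
qed

text \<open>If the finite sums were unbounded, there would be successive blocks of indices containing finite
  sets with sum of norm at least \<open>1\<close>; moving these sets to the front of their blocks gives
  a divergent rearrangement.\<close>
lemma unconditional_sums_bounded:
  fixes v :: "nat \<Rightarrow> 'a \<Rightarrow> real"
  assumes v: "\<And>k. v k \<in> X" and f: "f \<in> X"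
    and conv: "\<And>\<sigma>. bij \<sigma> \<Longrightarrow> (\<lambda>n. N (\<lambda>x. f x - (\<Sum>k<n. v (\<sigma> k) x))) \<longlonglongrightarrow> 0"
  shows "\<exists>B. \<forall>F. finite F \<longrightarrow> N (\<lambda>x. \<Sum>k\<in>F. v k x) \<le> B"
proof (rule ccontr)
  assume "\<not> ?thesis"
  then have "\<forall>m. \<exists>F. finite F \<and> F \<subseteq> {m..} \<and> 1 \<le> N (\<lambda>x. \<Sum>k\<in>F. v k x)"
    by (intro allI far_block_of_unbounded_sums v)
  from choice[OF this] obtain G
    where "\<forall>m. finite (G m) \<and> G m \<subseteq> {m..} \<and> 1 \<le> N (\<lambda>x. \<Sum>k\<in>G m. v k x)" ..
  then have G: "\<And>m. finite (G m)" "\<And>m. G m \<subseteq> {m..}" "\<And>m. 1 \<le> N (\<lambda>x. \<Sum>k\<in>G m. v k x)"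
    by simp_all
  \<comment> \<open>The next block starts just past the last index of the chosen set. Inserting
    \<open>i\<close> itself forces \<open>m\<close> to increase strictly.\<close>
  define m where "m = rec_nat 0 (\<lambda>_ i. Suc (Max (insert i (G i))))"
  have m0: "m 0 = 0" and mS: "m (Suc j) = Suc (Max (insert (m j) (G (m j))))" for j
    by (simp_all add: m_def)
  have m_less: "m j < m (Suc j)" for j using G(1) by (simp add: mS less_Suc_eq_le)
  then have mono: "strict_mono m" by (simp add: strict_mono_Suc_iff)
  define F where "F = (\<lambda>j. G (m j))"
  have F: "F j \<subseteq> {m j..<m (Suc j)}" "finite (F j)" "1 \<le> N (\<lambda>x. \<Sum>k\<in>F j. v k x)" for j
    using G(1) G(2)[of "m j"] G(3) by (auto simp: F_def mS less_Suc_eq_le intro!: Max_ge)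
  define b where "b = (\<lambda>k. THE j. m j \<le> k \<and> k < m (Suc j))"
  have b: "m (b k) \<le> k" "k < m (Suc (b k))" for k
    using theI'[OF strict_mono_block[OF mono m0, of k]] by (auto simp: b_def)
  have b_eq: "b k = j" if "m j \<le> k" "k < m (Suc j)" for k j
    using strict_mono_block[OF mono m0, of k] b[of k] that by blast
  have m_le: "i \<le> j \<Longrightarrow> m i \<le> m j" for i j using mono by (simp add: strict_mono_less_eq)
  \<comment> \<open>In block \<open>j\<close> the members of \<open>F j\<close> receive keys from
    \<open>2 * m j\<close> up to \<open>m j + m (Suc j)\<close>, the other indices keys from there
    up to \<open>2 * m (Suc j)\<close>, upper ends excluded. Blocks keep their order,
    \<open>F j\<close> comes first in its block, and the two thresholds cut out the initial segments
    needed below.\<close>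
  define key where "key = (\<lambda>k. if k \<in> F (b k) then k + m (b k) else k + m (Suc (b k)))"
  have key_ge: "2 * m (b k) \<le> key k" and key_lt: "key k < 2 * m (Suc (b k))" for k
    using b[of k] m_less[of "b k"] by (auto simp: key_def)
  have key_less: "key k < key l" if "b k < b l" for k l
    using key_lt[of k] key_ge[of l] m_le[of "Suc (b k)" "b l"] that by simp
  have inj: "inj key"
  proof (rule injI)
    fix k l assume eq: "key k = key l"
    then have "b k = b l" using key_less[of k l] key_less[of l k] by (metis less_irrefl nat_neq_iff)
    then show "k = l"
      using eq b[of k] b[of l] by (auto simp: key_def split: if_splits)
  qed
  have init1: "{k. key k < 2 * m j} = {..<m j}" for j
  proof -
    have "key k < 2 * m j \<longleftrightarrow> k < m j" for k
    proof (cases "b k < j")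
      case True
      then show ?thesis using key_lt[of k] b[of k] m_le[of "Suc (b k)" j] by auto
    next
      case False
      then show ?thesis using key_ge[of k] b[of k] m_le[of j "b k"] by auto
    qed
    then show ?thesis by auto
  qed
  have init2: "{k. key k < m j + m (Suc j)} = {..<m j} \<union> F j" for j
  proof -
    have "key k < m j + m (Suc j) \<longleftrightarrow> k < m j \<or> k \<in> F j" for k
    proof (cases "b k" j rule: linorder_cases)
      case less
      then show ?thesis using key_lt[of k] b[of k] m_le[of "Suc (b k)" j] m_less[of j] by auto
    next
      case equal
      then show ?thesis using b[of k] by (auto simp: key_def)
    next
      case greater
      then show ?thesis using key_ge[of k] b[of k] m_le[of "Suc j" "b k"] m_less[of j] F(1)[of j] by auto
    qed
    then show ?thesis by auto
  qed
  obtain \<sigma> :: "nat \<Rightarrow> nat" where "bij \<sigma> \<and> (\<forall>t. \<exists>n. \<sigma> ` {..<n} = {k. key k < t})"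
    using ex_bij_sorting_key[OF inj] ..
  then have \<sigma>: "bij \<sigma>" and img: "\<exists>n. \<sigma> ` {..<n} = {k. key k < t}" for t
    by simp_all
  have inj\<sigma>: "inj_on \<sigma> A" for A using \<sigma> by (metis bij_is_inj inj_on_subset subset_UNIV)
  have part: "(\<Sum>k<n. v (\<sigma> k) x) = (\<Sum>k\<in>\<sigma> ` {..<n}. v k x)" for n x
    by (simp add: sum.reindex[OF inj\<sigma>])
  have "\<forall>\<^sub>F n in sequentially. N (\<lambda>x. f x - (\<Sum>k<n. v (\<sigma> k) x)) < 1/2"
    using order_tendstoD(2)[OF conv[OF \<sigma>], of "1/2"] by simp
  then obtain j where j: "\<And>n. j \<le> n \<Longrightarrow> N (\<lambda>x. f x - (\<Sum>k<n. v (\<sigma> k) x)) < 1/2"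
    unfolding eventually_sequentially by blast
  obtain n1 where n1: "\<sigma> ` {..<n1} = {..<m j}"
    using img[of "2 * m j"] unfolding init1 ..
  obtain n2 where n2: "\<sigma> ` {..<n2} = {..<m j} \<union> F j"
    using img[of "m j + m (Suc j)"] unfolding init2 ..
  \<comment> \<open>Cardinality gives \<open>n1 = m j \<ge> j\<close>, so the convergence threshold
    \<open>j\<close> also serves as the block number. Both partial sums are then within 1/2 of
    \<open>f\<close>, although they differ by the sum over \<open>F j\<close>, whose norm is at
    least 1.\<close>
  have "n1 = m j" using card_image[OF inj\<sigma>, of "{..<n1}"] by (simp add: n1)
  then have "j \<le> n1" using strict_mono_imp_increasing[OF mono, of j] by simp
  moreover have "n1 \<le> n2"
    using card_image[OF inj\<sigma>, of "{..<n2}"] card_mono[of "{..<m j} \<union> F j" "{..<m j}"] F(2)[of j] \<open>n1 = m j\<close>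
    by (simp add: n2)
  ultimately have small: "N (\<lambda>x. f x - (\<Sum>k<n1. v (\<sigma> k) x)) < 1/2" "N (\<lambda>x. f x - (\<Sum>k<n2. v (\<sigma> k) x)) < 1/2"
    using j by auto
  have "(\<Sum>k\<in>F j. v k x) = (f x - (\<Sum>k<n1. v (\<sigma> k) x)) - (f x - (\<Sum>k<n2. v (\<sigma> k) x))" for x
    using F[of j] unfolding part n1 n2 by (subst sum.union_disjoint) auto
  then have "N (\<lambda>x. \<Sum>k\<in>F j. v k x) < 1"
    using N_diff_le[OF diff[OF f sum_mem] diff[OF f sum_mem], of "{..<n1}" "\<lambda>k. v (\<sigma> k)" "{..<n2}" "\<lambda>k. v (\<sigma> k)"] v small
    by simp
  then show False using F(3)[of j] by simp
qed

end

section \<open>Coefficients with respect to a normalized unconditional basis\<close>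

locale unconditional_fun_basis = complete_fun_space +
  fixes u
  assumes unconditional: "unconditional_basis X N u" and normalized: "\<And>k. N (u k) = 1"
begin

abbreviation coef :: "('a \<Rightarrow> real) \<Rightarrow> nat \<Rightarrow> real" where
  "coef \<equiv> basis_coef X N u"

abbreviation comb :: "nat set \<Rightarrow> (nat \<Rightarrow> real) \<Rightarrow> 'a \<Rightarrow> real" where
  "comb F c \<equiv> (\<lambda>x. \<Sum>k\<in>F. c k * u k x)"

lemma u_mem: "u k \<in> X"
  using unconditional by (simp add: unconditional_basis_def schauder_basis_def)

lemma comb_mem: "comb F c \<in> X"
  by (intro sum_mem scale u_mem)

lemma N_comb_le: "N (comb F c) \<le> (\<Sum>k\<in>F. \<bar>c k\<bar>)"
  using N_sum[of F "\<lambda>k x. c k * u k x", OF scale[OF u_mem]] by (simp add: N_scale[OF u_mem] normalized)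

lemma ex1_coef: "f \<in> X \<Longrightarrow> \<exists>!c. (\<lambda>n. N (\<lambda>x. f x - comb {..<n} c x)) \<longlonglongrightarrow> 0"
  using unconditional unfolding unconditional_basis_def schauder_basis_def by blast

lemma coef_tendsto: "f \<in> X \<Longrightarrow> (\<lambda>n. N (\<lambda>x. f x - comb {..<n} (coef f) x)) \<longlonglongrightarrow> 0"
  unfolding basis_coef_def by (rule theI'[OF ex1_coef])

lemma coef_unique: "f \<in> X \<Longrightarrow> (\<lambda>n. N (\<lambda>x. f x - comb {..<n} c x)) \<longlonglongrightarrow> 0 \<Longrightarrow> coef f = c"
  using ex1_coef[of f] coef_tendsto[of f] by blast

lemma coef_linear:
  assumes f: "f \<in> X" and g: "g \<in> X"
  shows "coef (\<lambda>x. a * f x + b * g x) = (\<lambda>k. a * coef f k + b * coef g k)"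
proof (rule coef_unique)
  show "(\<lambda>x. a * f x + b * g x) \<in> X" by (intro add scale f g)
  let ?R = "\<lambda>h n x. h x - comb {..<n} (coef h) x"
  have R: "?R h n \<in> X" if "h \<in> X" for h n by (intro diff comb_mem that)
  have le: "N (\<lambda>x. a * f x + b * g x - comb {..<n} (\<lambda>k. a * coef f k + b * coef g k) x)
      \<le> \<bar>a\<bar> * N (?R f n) + \<bar>b\<bar> * N (?R g n)" for n
  proof -
    have "(\<lambda>x. a * f x + b * g x - comb {..<n} (\<lambda>k. a * coef f k + b * coef g k) x)
        = (\<lambda>x. a * ?R f n x + b * ?R g n x)"
      by (simp add: algebra_simps sum.distrib sum_distrib_left)
    then show ?thesis
      using N_add[OF scale[OF R[OF f]] scale[OF R[OF g]], of a n b n]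
      by (simp only: N_scale[OF R[OF f]] N_scale[OF R[OF g]])
  qed
  have "(\<lambda>n. \<bar>a\<bar> * N (?R f n) + \<bar>b\<bar> * N (?R g n)) \<longlonglongrightarrow> \<bar>a\<bar> * 0 + \<bar>b\<bar> * 0"
    by (intro tendsto_intros coef_tendsto f g)
  then show "(\<lambda>n. N (\<lambda>x. a * f x + b * g x - comb {..<n} (\<lambda>k. a * coef f k + b * coef g k) x)) \<longlonglongrightarrow> 0"
    by (intro N_tendsto_zero[OF _ le] diff add scale comb_mem f g) simp
qed

lemma coef_add: "f \<in> X \<Longrightarrow> g \<in> X \<Longrightarrow> coef (\<lambda>x. f x + g x) k = coef f k + coef g k"
  using coef_linear[of f g 1 1] by simp

lemma coef_scale: "f \<in> X \<Longrightarrow> coef (\<lambda>x. c * f x) k = c * coef f k"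
  using coef_linear[of f f c 0] by simp

lemma coef_sum:
  "finite I \<Longrightarrow> (\<And>i. i \<in> I \<Longrightarrow> z i \<in> X) \<Longrightarrow> coef (\<lambda>x. \<Sum>i\<in>I. z i x) k = (\<Sum>i\<in>I. coef (z i) k)"
proof (induction I rule: finite_induct)
  case empty
  show ?case using coef_scale[OF zero, of 0] by simp
next
  case (insert i I)
  then show ?case by (simp add: coef_add sum_mem)
qed

lemma coef_comb:
  assumes "finite F"
  shows "coef (comb F c) = (\<lambda>k. if k \<in> F then c k else 0)" (is "_ = ?c")
proof (rule coef_unique[OF comb_mem])
  obtain n0 where n0: "F \<subseteq> {..<n0}" using finite_nat_bounded[OF assms] by blast
  have "comb {..<n} ?c = comb F c" if "n0 \<le> n" for n
  proof
    fix x
    have "comb {..<n} ?c x = (\<Sum>k<n. if k \<in> F then c k * u k x else 0)"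
      by (intro sum.cong) auto
    also have "\<dots> = (\<Sum>k\<in>{..<n} \<inter> F. c k * u k x)" by (simp add: sum.inter_restrict)
    also have "{..<n} \<inter> F = F" using n0 that by auto
    finally show "comb {..<n} ?c x = comb F c x" .
  qed
  note eq = fun_cong[OF this]
  have "N (\<lambda>x. comb F c x - comb {..<n} ?c x) = 0" if "n0 \<le> n" for n
    unfolding eq[OF that] by simp
  then show "(\<lambda>n. N (\<lambda>x. comb F c x - comb {..<n} ?c x)) \<longlonglongrightarrow> 0"
    by (intro tendsto_eventually eventually_sequentiallyI)
qed

section \<open>Uniform boundedness of the finite coordinate projections\<close>

lemma finite_parts_bounded:
  assumes f: "f \<in> X"
  shows "\<exists>B. \<forall>F. finite F \<longrightarrow> N (comb F (coef f)) \<le> B"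
proof (rule unconditional_sums_bounded[OF scale[OF u_mem] f])
  fix \<sigma> :: "nat \<Rightarrow> nat" assume "bij \<sigma>"
  then show "(\<lambda>n. N (\<lambda>x. f x - (\<Sum>k<n. coef f (\<sigma> k) * u (\<sigma> k) x))) \<longlonglongrightarrow> 0"
    using unconditional f unfolding unconditional_basis_def by blast
qed

definition part_norm :: "('a \<Rightarrow> real) \<Rightarrow> real" where
  "part_norm f = (SUP F\<in>{F. finite F}. N (comb F (coef f)))"

lemma N_comb_le_part_norm: "f \<in> X \<Longrightarrow> finite F \<Longrightarrow> N (comb F (coef f)) \<le> part_norm f"
  unfolding part_norm_def using finite_parts_bounded[of f]
  by (intro cSUP_upper) (auto simp: bdd_above_def)

lemma part_norm_le: "(\<And>F. finite F \<Longrightarrow> N (comb F (coef f)) \<le> B) \<Longrightarrow> part_norm f \<le> B"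
  unfolding part_norm_def by (intro cSUP_least) (auto intro: exI[of _ "{}"])

lemma abs_coef_le_part_norm: "f \<in> X \<Longrightarrow> \<bar>coef f k\<bar> \<le> part_norm f"
  using N_comb_le_part_norm[of f "{k}"] by (simp add: N_scale[OF u_mem] normalized)

lemma part_norm_nonneg: "f \<in> X \<Longrightarrow> 0 \<le> part_norm f"
  using N_comb_le_part_norm[of f "{}"] by simp

lemma part_norm_scale_le:
  assumes "f \<in> X"
  shows "part_norm (\<lambda>x. c * f x) \<le> \<bar>c\<bar> * part_norm f"
proof (rule part_norm_le)
  fix F :: "nat set" assume F: "finite F"
  have "N (comb F (coef (\<lambda>x. c * f x))) = \<bar>c\<bar> * N (comb F (coef f))"
    using N_scale[OF comb_mem[of "coef f" F], of c] by (simp add: coef_scale[OF assms] sum_distrib_left mult.assoc)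
  then show "N (comb F (coef (\<lambda>x. c * f x))) \<le> \<bar>c\<bar> * part_norm f"
    using N_comb_le_part_norm[OF assms F] by (simp add: mult_left_mono)
qed

lemma part_norm_scale:
  assumes f: "f \<in> X"
  shows "part_norm (\<lambda>x. c * f x) = \<bar>c\<bar> * part_norm f"
proof (cases "c = 0")
  case True
  then show ?thesis
    using part_norm_scale_le[OF f, of 0] part_norm_nonneg[OF scale[OF f], of 0] by simp
next
  case False
  have "part_norm f \<le> \<bar>1/c\<bar> * part_norm (\<lambda>x. c * f x)"
    using part_norm_scale_le[OF scale[OF f], of "1/c" c] False by simp
  then show ?thesis
    using part_norm_scale_le[OF f, of c] False by (simp add: field_simps)
qed

lemma part_norm_add:
  assumes f: "f \<in> X" and g: "g \<in> X"
  shows "part_norm (\<lambda>x. f x + g x) \<le> part_norm f + part_norm g"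
proof (rule part_norm_le)
  fix F :: "nat set" assume F: "finite F"
  have "N (comb F (coef (\<lambda>x. f x + g x))) = N (\<lambda>x. comb F (coef f) x + comb F (coef g) x)"
    by (simp add: coef_add[OF f g] sum.distrib distrib_right)
  also have "\<dots> \<le> N (comb F (coef f)) + N (comb F (coef g))" by (intro N_add comb_mem)
  also have "\<dots> \<le> part_norm f + part_norm g" by (intro add_mono N_comb_le_part_norm f g F)
  finally show "N (comb F (coef (\<lambda>x. f x + g x))) \<le> part_norm f + part_norm g" .
qed

text \<open>A fixed finite \<open>F\<close> involves only finitely many coefficient series.
  Truncating them all at \<open>J\<close> leaves a finite sum of parts of the \<open>z i\<close>,
  controlled by the triangle inequality, and the truncation error vanishes as \<open>J\<close>
  grows.\<close>

lemma N_suminf_coef_le: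
  assumes z: "\<And>i. z i \<in> X" and summ: "summable (\<lambda>i. part_norm (z i))" and F: "finite F"
  shows "N (comb F (\<lambda>k. \<Sum>i. coef (z i) k)) \<le> (\<Sum>i. part_norm (z i))"
proof -
  have coef_summ: "summable (\<lambda>i. coef (z i) k)" for k
    using summ by (rule summable_comparison_test'[where N = 0]) (simp add: abs_coef_le_part_norm z)
  have le: "N (comb F (\<lambda>k. \<Sum>i. coef (z i) k))
      \<le> (\<Sum>k\<in>F. \<bar>(\<Sum>i. coef (z i) k) - (\<Sum>i<J. coef (z i) k)\<bar>) + (\<Sum>i. part_norm (z i))" for J
  proof -
    have "N (comb F (\<lambda>k. \<Sum>i. coef (z i) k))
        \<le> N (\<lambda>x. comb F (\<lambda>k. \<Sum>i. coef (z i) k) x - comb F (\<lambda>k. \<Sum>i<J. coef (z i) k) x)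
          + N (comb F (\<lambda>k. \<Sum>i<J. coef (z i) k))"
      by (intro N_le_diff comb_mem)
    also have "(\<lambda>x. comb F (\<lambda>k. \<Sum>i. coef (z i) k) x - comb F (\<lambda>k. \<Sum>i<J. coef (z i) k) x)
        = comb F (\<lambda>k. (\<Sum>i. coef (z i) k) - (\<Sum>i<J. coef (z i) k))"
      by (simp add: sum_subtractf left_diff_distrib)
    also have "N \<dots> \<le> (\<Sum>k\<in>F. \<bar>(\<Sum>i. coef (z i) k) - (\<Sum>i<J. coef (z i) k)\<bar>)"
      by (rule N_comb_le)
    also have "comb F (\<lambda>k. \<Sum>i<J. coef (z i) k) = (\<lambda>x. \<Sum>i<J. comb F (coef (z i)) x)"
      by (simp add: sum_distrib_right sum.swap[of _ "{..<J}"])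
    also have "N \<dots> \<le> (\<Sum>i<J. N (comb F (coef (z i))))" by (intro N_sum comb_mem)
    also have "\<dots> \<le> (\<Sum>i<J. part_norm (z i))" by (intro sum_mono N_comb_le_part_norm z F)
    also have "\<dots> \<le> (\<Sum>i. part_norm (z i))"
      by (intro sum_le_suminf summ) (auto simp: part_norm_nonneg z)
    finally show ?thesis by simp
  qed
  have "(\<lambda>J. (\<Sum>k\<in>F. \<bar>(\<Sum>i. coef (z i) k) - (\<Sum>i<J. coef (z i) k)\<bar>) + (\<Sum>i. part_norm (z i)))
      \<longlonglongrightarrow> (\<Sum>k\<in>F. \<bar>(\<Sum>i. coef (z i) k) - (\<Sum>i. coef (z i) k)\<bar>) + (\<Sum>i. part_norm (z i))"
    by (intro tendsto_intros summable_LIMSEQ coef_summ)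
  then show ?thesis
    using le by (intro LIMSEQ_le_const) auto
qed

text \<open>By uniqueness it suffices that the expansion with the summed coefficients converges to
  \<open>f\<close>. Continuity of the coefficient functionals is not yet available; summability of
  the part norms replaces it. The three thirds of \<open>e\<close> pay for passing from
  \<open>f\<close> to a partial sum \<open>g\<close>, from \<open>g\<close> to its own expansion,
  and for the tail of the coefficient series, the last uniformly in \<open>n\<close> by
  \<open>N_suminf_coef_le\<close>.\<close>

lemma coef_suminf:
  assumes z: "\<And>i. z i \<in> X" and f: "f \<in> X" and summ: "summable (\<lambda>i. part_norm (z i))"
    and lim: "(\<lambda>n. N (\<lambda>x. f x - (\<Sum>i<n. z i x))) \<longlonglongrightarrow> 0"
  shows "coef f = (\<lambda>k. \<Sum>i. coef (z i) k)" (is "_ = ?c")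
proof (rule coef_unique[OF f], rule LIMSEQ_I)
  fix e :: real assume e: "0 < e"
  have coef_summ: "summable (\<lambda>i. coef (z i) k)" for k
    using summ by (rule summable_comparison_test'[where N = 0]) (simp add: abs_coef_le_part_norm z)
  have "\<forall>\<^sub>F I in sequentially. N (\<lambda>x. f x - (\<Sum>i<I. z i x)) < e/3"
    using order_tendstoD(2)[OF lim, of "e/3"] e by simp
  moreover have "\<forall>\<^sub>F I in sequentially. \<bar>\<Sum>i. part_norm (z (i + I))\<bar> < e/3"
    using suminf_exist_split[OF _ summ, of "e/3"] e by (auto simp: eventually_sequentially)
  ultimately have "\<forall>\<^sub>F I in sequentially. N (\<lambda>x. f x - (\<Sum>i<I. z i x)) < e/3 \<and>
      \<bar>\<Sum>i. part_norm (z (i + I))\<bar> < e/3" by (rule eventually_conj)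
  then obtain I where I: "N (\<lambda>x. f x - (\<Sum>i<I. z i x)) < e/3" "\<bar>\<Sum>i. part_norm (z (i + I))\<bar> < e/3"
    using eventually_happens'[OF sequentially_bot] by blast
  define g where "g = (\<lambda>x. \<Sum>i<I. z i x)"
  have g: "g \<in> X" unfolding g_def by (intro sum_mem z)
  have "\<forall>\<^sub>F n in sequentially. N (\<lambda>x. g x - comb {..<n} (coef g) x) < e/3"
    using order_tendstoD(2)[OF coef_tendsto[OF g], of "e/3"] e by simp
  then obtain n0 where n0: "\<And>n. n0 \<le> n \<Longrightarrow> N (\<lambda>x. g x - comb {..<n} (coef g) x) < e/3"
    unfolding eventually_sequentially by blast
  have "norm (N (\<lambda>x. f x - comb {..<n} ?c x) - 0) < e" if n: "n0 \<le> n" for n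
  proof -
    have "(\<lambda>x. comb {..<n} (coef g) x - comb {..<n} ?c x)
        = (\<lambda>x. -1 * comb {..<n} (\<lambda>k. \<Sum>i. coef (z (i + I)) k) x)"
      unfolding g_def
      by (simp add: coef_sum z suminf_minus_initial_segment[OF coef_summ] left_diff_distrib sum_subtractf)
    then have "N (\<lambda>x. comb {..<n} (coef g) x - comb {..<n} ?c x)
        = N (comb {..<n} (\<lambda>k. \<Sum>i. coef (z (i + I)) k))"
      using N_scale[OF comb_mem, of "-1"] by simp
    also have "\<dots> \<le> (\<Sum>i. part_norm (z (i + I)))"
      by (intro N_suminf_coef_le[of "\<lambda>i. z (i + I)"] z summable_ignore_initial_segment[OF summ] finite_lessThan)
    finally have 1: "N (\<lambda>x. comb {..<n} (coef g) x - comb {..<n} ?c x) < e/3" using I by simp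
    have "N (\<lambda>x. f x - comb {..<n} ?c x) \<le> N (\<lambda>x. f x - g x) + N (\<lambda>x. g x - comb {..<n} ?c x)"
      by (intro N_triangle f g comb_mem)
    also have "N (\<lambda>x. g x - comb {..<n} ?c x)
        \<le> N (\<lambda>x. g x - comb {..<n} (coef g) x) + N (\<lambda>x. comb {..<n} (coef g) x - comb {..<n} ?c x)"
      by (intro N_triangle g comb_mem)
    finally have "N (\<lambda>x. f x - comb {..<n} ?c x) < e"
      using 1 n0[OF n] I(1) by (simp add: g_def)
    then show ?thesis using N_nonneg[OF diff[OF f comb_mem]] by simp
  qed
  then show "\<exists>n0. \<forall>n\<ge>n0. norm (N (\<lambda>x. f x - comb {..<n} ?c x) - 0) < e" by blast
qed

text \<open>Zabreiko's lemma applies because \<open>coef_suminf\<close> and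
  \<open>N_suminf_coef_le\<close> make \<open>part_norm\<close> countably subadditive.\<close>

lemma part_norm_bounded: "\<exists>K. \<forall>f\<in>X. part_norm f \<le> K * N f"
proof -
  have sub: "part_norm f \<le> (\<Sum>i. part_norm (z i))"
    if "\<And>i. z i \<in> X" "f \<in> X" "summable (\<lambda>i. part_norm (z i))"
      "(\<lambda>n. N (\<lambda>x. f x - (\<Sum>i<n. z i x))) \<longlonglongrightarrow> 0" for z f
    using N_suminf_coef_le[OF that(1,3)] by (intro part_norm_le) (simp add: coef_suminf[OF that])
  obtain K where "\<And>f. f \<in> X \<Longrightarrow> part_norm f \<le> K * N f"
    by (rule countably_subadditive_bounded[of part_norm, OF part_norm_nonneg part_norm_scale part_norm_add sub]) blast+
  then show ?thesis by blast
qed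

text \<open>Splitting the indices by the sign of the coefficient removes the absolute values. Each
  half is a finite part of the expansion, of norm at most \<open>K * N f\<close>, whence the factor
  2 in the constant.\<close>

lemma weighted_coef_summable_bounded:
  fixes b :: "nat \<Rightarrow> real"
  assumes b_nonneg: "\<And>k. 0 \<le> b k"
    and bound: "\<And>F c. finite F \<Longrightarrow> \<bar>\<Sum>k\<in>F. c k * b k\<bar> \<le> C * N (comb F c)"
  shows "\<exists>K. \<forall>f\<in>X. summable (\<lambda>k. \<bar>coef f k\<bar> * b k) \<and> (\<Sum>k. \<bar>coef f k\<bar> * b k) \<le> K * N f"
proof -
  obtain K where K: "\<And>f. f \<in> X \<Longrightarrow> part_norm f \<le> K * N f" using part_norm_bounded by blast
  have C: "0 \<le> C" using bound[of "{0}" "\<lambda>_. 1"] by (simp add: normalized)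
  have fin: "(\<Sum>k<n. \<bar>coef f k\<bar> * b k) \<le> (2 * C * K) * N f" if f: "f \<in> X" for f n
  proof -
    let ?P = "{k\<in>{..<n}. 0 \<le> coef f k}" and ?Q = "{k\<in>{..<n}. \<not> 0 \<le> coef f k}"
    have part: "\<bar>\<Sum>k\<in>F. coef f k * b k\<bar> \<le> C * (K * N f)" if "finite F" for F
      using bound[OF that, of "coef f"] N_comb_le_part_norm[OF f that] K[OF f] C
      by (meson mult_left_mono order_trans)
    have "(\<Sum>k<n. \<bar>coef f k\<bar> * b k) = (\<Sum>k\<in>?P \<union> ?Q. \<bar>coef f k\<bar> * b k)"
      by (intro sum.cong) auto
    also have "\<dots> = (\<Sum>k\<in>?P. \<bar>coef f k\<bar> * b k) + (\<Sum>k\<in>?Q. \<bar>coef f k\<bar> * b k)"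
      by (intro sum.union_disjoint) auto
    also have "(\<Sum>k\<in>?P. \<bar>coef f k\<bar> * b k) = (\<Sum>k\<in>?P. coef f k * b k)"
      by (intro sum.cong) auto
    also have "(\<Sum>k\<in>?Q. \<bar>coef f k\<bar> * b k) = - (\<Sum>k\<in>?Q. coef f k * b k)"
      by (simp add: sum_negf[symmetric])
    finally show ?thesis using part[of ?P] part[of ?Q] by simp
  qed
  have "summable (\<lambda>k. \<bar>coef f k\<bar> * b k) \<and> (\<Sum>k. \<bar>coef f k\<bar> * b k) \<le> (2 * C * K) * N f" if f: "f \<in> X" for f
  proof
    show s: "summable (\<lambda>k. \<bar>coef f k\<bar> * b k)"
      using fin[OF f] b_nonneg by (intro bounded_imp_summable[of _ "(2 * C * K) * N f"])
        (auto simp: lessThan_Suc_atMost[symmetric] simp del: sum.lessThan_Suc)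
    show "(\<Sum>k. \<bar>coef f k\<bar> * b k) \<le> (2 * C * K) * N f"
      by (intro suminf_le_const[OF s] fin f)
  qed
  then show ?thesis by blast
qed

text \<open>These are the bounded multipliers, that is, the functionals on l^1, composed with the
  operator sending \<open>f\<close> to the sequence \<open>coef f k * b k\<close>. They transport
  weak convergence from \<open>X\<close> to l^1.\<close>

lemma bdd_lin_fun_weighted_coef:
  fixes b \<epsilon> :: "nat \<Rightarrow> real"
  assumes b_nonneg: "\<And>k. 0 \<le> b k"
    and bound: "\<And>F c. finite F \<Longrightarrow> \<bar>\<Sum>k\<in>F. c k * b k\<bar> \<le> C * N (comb F c)"
    and \<epsilon>: "\<And>k. \<bar>\<epsilon> k\<bar> \<le> 1"
  shows "bdd_lin_fun X N (\<lambda>f. \<Sum>k. \<epsilon> k * (coef f k * b k))"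
proof -
  obtain K where "\<forall>f\<in>X. summable (\<lambda>k. \<bar>coef f k\<bar> * b k) \<and> (\<Sum>k. \<bar>coef f k\<bar> * b k) \<le> K * N f"
    using weighted_coef_summable_bounded[OF b_nonneg bound] ..
  then have K: "summable (\<lambda>k. \<bar>coef f k\<bar> * b k)" "(\<Sum>k. \<bar>coef f k\<bar> * b k) \<le> K * N f"
    if "f \<in> X" for f
    using that by blast+
  have le: "\<bar>\<epsilon> k * (coef f k * b k)\<bar> \<le> \<bar>coef f k\<bar> * b k" for f k
    using mult_right_mono[OF \<epsilon>, of "\<bar>coef f k\<bar> * b k" k] b_nonneg by (simp add: abs_mult)
  have summ: "summable (\<lambda>k. \<epsilon> k * (coef f k * b k))" if "f \<in> X" for f
    using K(1)[OF that] by (rule summable_comparison_test'[where N = 0]) (simp only: real_norm_def le)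
  show ?thesis unfolding bdd_lin_fun_def
  proof (intro conjI ballI allI exI)
    fix f g :: "'a \<Rightarrow> real" and s t :: real assume f: "f \<in> X" and g: "g \<in> X"
    have "(\<Sum>k. \<epsilon> k * (coef (\<lambda>x. s * f x + t * g x) k * b k))
        = (\<Sum>k. s * (\<epsilon> k * (coef f k * b k)) + t * (\<epsilon> k * (coef g k * b k)))"
      by (simp add: coef_linear[OF f g] algebra_simps)
    also have "\<dots> = s * (\<Sum>k. \<epsilon> k * (coef f k * b k)) + t * (\<Sum>k. \<epsilon> k * (coef g k * b k))"
      by (simp add: suminf_add[symmetric] suminf_mult summable_mult summ f g)
    finally show "(\<Sum>k. \<epsilon> k * (coef (\<lambda>x. s * f x + t * g x) k * b k))
        = s * (\<Sum>k. \<epsilon> k * (coef f k * b k)) + t * (\<Sum>k. \<epsilon> k * (coef g k * b k))" .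
  next
    fix f assume f: "f \<in> X"
    have "summable (\<lambda>k. \<bar>\<epsilon> k * (coef f k * b k)\<bar>)"
      using K(1)[OF f] by (rule summable_comparison_test'[where N = 0]) (simp only: real_norm_def abs_abs le)
    then have "\<bar>\<Sum>k. \<epsilon> k * (coef f k * b k)\<bar> \<le> (\<Sum>k. \<bar>coef f k\<bar> * b k)"
      using summable_rabs suminf_le[OF le _ K(1)[OF f]] by (meson order_trans)
    then show "\<bar>\<Sum>k. \<epsilon> k * (coef f k * b k)\<bar> \<le> K * N f" using K(2)[OF f] by linarith
  qed
qed

end

section \<open>Schur property and Rademacher sequences\<close>

text \<open>The Schur property of \<open>\<ell>\<^sup>1\<close>, by a gliding hump.\<close>
lemma weak_null_imp_small_l1:
  fixes x :: "nat \<Rightarrow> nat \<Rightarrow> real"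
  assumes summ: "\<And>n. summable (\<lambda>k. \<bar>x n k\<bar>)"
    and weak: "\<And>\<epsilon>. (\<And>k. \<bar>\<epsilon> k\<bar> \<le> 1) \<Longrightarrow> (\<lambda>n. \<Sum>k. \<epsilon> k * x n k) \<longlonglongrightarrow> 0"
    and "0 < \<delta>"
  shows "\<exists>n. (\<Sum>k. \<bar>x n k\<bar>) < \<delta>"
proof (rule ccontr)
  assume "\<not> ?thesis"
  then have big: "\<delta> \<le> (\<Sum>k. \<bar>x n k\<bar>)" for n by (simp add: not_less)
  have coord: "(\<lambda>n. x n k) \<longlonglongrightarrow> 0" for k
  proof -
    have "(\<Sum>i. indicator {k} i * x n i) = x n k" for n
      using suminf_finite[of "{k}" "\<lambda>i. indicator {k} i * x n i"] by simp
    then show ?thesis using weak[of "indicator {k}"] by (simp add: indicator_def)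
  qed
  \<comment> \<open>Coordinatewise convergence makes the mass before \<open>m\<close> small in some
    late row, and summability of that row makes its mass beyond some \<open>M'\<close> small. The
    hump lies between.\<close>
  have "\<exists>n M'. m \<le> n \<and> m < M' \<and> (\<Sum>k<m. \<bar>x n k\<bar>) < \<delta>/5 \<and> (\<Sum>k. \<bar>x n (k + M')\<bar>) < \<delta>/5" for m
  proof -
    have "(\<lambda>n. \<Sum>k<m. \<bar>x n k\<bar>) \<longlonglongrightarrow> (\<Sum>k<m. \<bar>0\<bar>)"
      by (intro tendsto_intros coord)
    then have "\<forall>\<^sub>F n in sequentially. (\<Sum>k<m. \<bar>x n k\<bar>) < \<delta>/5"
      using \<open>0 < \<delta>\<close> by (intro order_tendstoD(2)) auto
    then have "\<forall>\<^sub>F n in sequentially. m \<le> n \<and> (\<Sum>k<m. \<bar>x n k\<bar>) < \<delta>/5"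
      by (intro eventually_conj eventually_ge_at_top)
    then obtain n where n: "m \<le> n" "(\<Sum>k<m. \<bar>x n k\<bar>) < \<delta>/5"
      using eventually_happens'[OF sequentially_bot] by blast
    obtain M0 where M0: "\<And>M. M0 \<le> M \<Longrightarrow> norm (\<Sum>k. \<bar>x n (k + M)\<bar>) < \<delta>/5"
      using suminf_exist_split[OF _ summ[of n], of "\<delta>/5"] \<open>0 < \<delta>\<close> by auto
    have "(\<Sum>k. \<bar>x n (k + max M0 (Suc m))\<bar>) < \<delta>/5" using M0[of "max M0 (Suc m)"] by simp
    then show ?thesis using n by (intro exI[of _ n] exI[of _ "max M0 (Suc m)"]) auto
  qed
  then obtain \<nu> g where g: "\<And>m. m \<le> \<nu> m" "\<And>m. m < g m" "\<And>m. (\<Sum>k<m. \<bar>x (\<nu> m) k\<bar>) < \<delta>/5"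
      "\<And>m. (\<Sum>k. \<bar>x (\<nu> m) (k + g m)\<bar>) < \<delta>/5"
    by metis
  define m where "m = rec_nat 0 (\<lambda>_. g)"
  have m0: "m 0 = 0" and mS: "m (Suc j) = g (m j)" for j by (simp_all add: m_def)
  have mono: "strict_mono m" by (simp add: strict_mono_Suc_iff mS g)
  define b where "b = (\<lambda>k. THE j. m j \<le> k \<and> k < m (Suc j))"
  have b_eq: "b k = j" if "m j \<le> k" "k < m (Suc j)" for k j
    unfolding b_def using strict_mono_block[OF mono m0, of k] that by (intro the1_equality) auto
  \<comment> \<open>On the block starting at \<open>m j\<close> the signs copy the row
    \<open>\<nu> (m j)\<close>, whose hump sits there.\<close>
  define \<epsilon> where "\<epsilon> = (\<lambda>k. sgn (x (\<nu> (m (b k))) k))"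
  have \<epsilon>: "\<bar>\<epsilon> k\<bar> \<le> 1" for k by (simp add: \<epsilon>_def abs_sgn_eq)
  have "\<forall>\<^sub>F n in sequentially. \<bar>\<Sum>k. \<epsilon> k * x n k\<bar> < \<delta>/5"
    using order_tendstoD(2)[OF tendsto_rabs_zero[OF weak[OF \<epsilon>]], of "\<delta>/5"] \<open>0 < \<delta>\<close> by simp
  then obtain j where j: "\<And>n. j \<le> n \<Longrightarrow> \<bar>\<Sum>k. \<epsilon> k * x n k\<bar> < \<delta>/5"
    unfolding eventually_sequentially by blast
  define n where "n = \<nu> (m j)"
  have "j \<le> n" using g(1)[of "m j"] strict_mono_imp_increasing[OF mono, of j] by (simp add: n_def)
  \<comment> \<open>\<open>y\<close> measures what the signs fail to recover from the absolute
    values: nothing on the block of the hump, at most \<open>2 * \<bar>x n k\<bar>\<close>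
    elsewhere. Each side of the block contributes less than two fifths of \<open>\<delta>\<close>,
    and the signed sum itself less than one fifth, which leaves a total below
    \<open>\<delta>\<close>.\<close>
  define y where "y = (\<lambda>k. \<bar>x n k\<bar> - \<epsilon> k * x n k)"
  have ex_le: "\<bar>\<epsilon> k * x n k\<bar> \<le> \<bar>x n k\<bar>" for k
    using mult_right_mono[OF \<epsilon>, of "\<bar>x n k\<bar>" k] by (simp add: abs_mult)
  have ex_summ: "summable (\<lambda>k. \<epsilon> k * x n k)"
    using summ[of n] by (rule summable_comparison_test'[where N = 0]) (simp only: real_norm_def ex_le)
  have y_le: "y k \<le> 2 * \<bar>x n k\<bar>" for k using ex_le[of k] by (simp add: y_def)
  have y_summ: "summable y" unfolding y_def by (intro summable_diff summ ex_summ)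
  have y0: "y k = 0" if "m j \<le> k" "k < m (Suc j)" for k
    using b_eq[OF that] by (simp add: y_def \<epsilon>_def n_def abs_sgn mult.commute)
  have "(\<Sum>k<m (Suc j). y k) = (\<Sum>k<m j. y k)"
    using y0 strict_monoD[OF mono, of j "Suc j"] by (intro sum.mono_neutral_right) auto
  also have "\<dots> \<le> (\<Sum>k<m j. 2 * \<bar>x n k\<bar>)" by (intro sum_mono y_le)
  also have "\<dots> < 2 * (\<delta>/5)" using g(3)[of "m j"] by (simp add: n_def sum_distrib_left[symmetric])
  finally have 1: "(\<Sum>k<m (Suc j). y k) < 2 * (\<delta>/5)" .
  have "(\<Sum>k. y (k + m (Suc j))) \<le> (\<Sum>k. 2 * \<bar>x n (k + m (Suc j))\<bar>)"
    by (intro suminf_le y_le summable_mult summable_ignore_initial_segment y_summ summable_ignore_initial_segment[OF summ])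
  also have "\<dots> = 2 * (\<Sum>k. \<bar>x n (k + m (Suc j))\<bar>)"
    by (intro suminf_mult summable_ignore_initial_segment[OF summ])
  also have "\<dots> < 2 * (\<delta>/5)" using g(4)[of "m j"] by (simp add: n_def mS)
  finally have "(\<Sum>k. y k) < 4 * (\<delta>/5)"
    using 1 suminf_split_initial_segment[OF y_summ, of "m (Suc j)"] by simp
  moreover have "(\<Sum>k. y k) = (\<Sum>k. \<bar>x n k\<bar>) - (\<Sum>k. \<epsilon> k * x n k)"
    unfolding y_def by (intro suminf_diff[symmetric] summ ex_summ)
  ultimately show False using big[of n] j[OF \<open>j \<le> n\<close>] by linarith
qed

section \<open>Halving sets in an atomless finite measure space\<close>

context finite_measure
begin

text \<open>Whenever a set is split into two pieces of positive measure, one of them has at most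
  half the measure; iterate.\<close>

lemma atomless_small_subset:
  assumes "atomless M" "A \<in> sets M" "0 < measure M A" "0 < e"
  shows "\<exists>B\<in>sets M. B \<subseteq> A \<and> 0 < measure M B \<and> measure M B < e"
proof -
  have "\<exists>B\<in>sets M. B \<subseteq> A \<and> 0 < measure M B \<and> measure M B \<le> measure M A * (1/2)^n" for n
  proof (induction n)
    case 0
    then show ?case using assms by auto
  next
    case (Suc n)
    then obtain B where B: "B \<in> sets M" "B \<subseteq> A" "0 < measure M B" "measure M B \<le> measure M A * (1/2)^n"
      by blast
    then obtain C where C: "C \<in> sets M" "C \<subseteq> B" "0 < measure M C" "measure M C < measure M B"
      using assms(1) unfolding atomless_def by blast
    have D: "measure M (B - C) = measure M B - measure M C"
      using B C by (intro finite_measure_Diff)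
    show ?case
    proof (cases "measure M C \<le> measure M B / 2")
      case True
      then show ?thesis using B C by (intro bexI[of _ C]) auto
    next
      case False
      then show ?thesis using B C D by (intro bexI[of _ "B - C"]) auto
    qed
  qed
  moreover have "\<exists>n. (1/2)^n < e / measure M A"
    using assms by (intro real_arch_pow_inv) auto
  then obtain n where "measure M A * (1/2)^n < e" using assms by (auto simp: field_simps)
  ultimately show ?thesis by (meson le_less_trans)
qed

text \<open>Greedy exhaustion: each step adds a set of at least half the largest possible measure.\<close>
lemma atomless_subset_of_measure:
  assumes atomless: "atomless M" and A: "A \<in> sets M" and t: "0 \<le> t" "t \<le> measure M A"
  shows "\<exists>B\<in>sets M. B \<subseteq> A \<and> measure M B = t"
proof -
  define Q where "Q = (\<lambda>B. B \<in> sets M \<and> B \<subseteq> A \<and> measure M B \<le> t)"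
  have step: "\<exists>B'. Q B' \<and> (B \<subseteq> B' \<and> (\<forall>C\<in>sets M. C \<subseteq> A - B \<longrightarrow> measure M C \<le> t - measure M B \<longrightarrow>
      measure M C \<le> 2 * (measure M B' - measure M B)))" if B: "Q B" for B
  proof -
    define S where "S = measure M ` {C\<in>sets M. C \<subseteq> A - B \<and> measure M C \<le> t - measure M B}"
    have S0: "0 \<in> S" using B by (auto simp: S_def Q_def intro!: image_eqI[of _ _ "{}"])
    have bdd: "bdd_above S" by (auto simp: S_def bdd_above_def)
    \<comment> \<open>If the supremum is not positive, the empty set will do; otherwise half of it
      lies strictly below it.\<close>
    have "\<exists>s\<in>S. Sup S / 2 \<le> s"
    proof (cases "Sup S \<le> 0")
      case True
      then show ?thesis using S0 by (intro bexI[of _ 0]) auto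
    next
      case False
      then show ?thesis using less_cSupE[of "Sup S / 2" S] S0 by (auto intro: less_imp_le)
    qed
    then obtain C where C: "C \<in> sets M" "C \<subseteq> A - B" "measure M C \<le> t - measure M B" "Sup S / 2 \<le> measure M C"
      by (auto simp: S_def)
    have union: "measure M (B \<union> C) = measure M B + measure M C"
      using B C by (intro finite_measure_Union) (auto simp: Q_def)
    have "measure M D \<le> 2 * (measure M (B \<union> C) - measure M B)"
      if "D \<in> sets M" "D \<subseteq> A - B" "measure M D \<le> t - measure M B" for D
      using cSup_upper[OF _ bdd, of "measure M D"] that C(4) union by (auto simp: S_def)
    then show ?thesis using B C union by (intro exI[of _ "B \<union> C"]) (auto simp: Q_def)
  qed
  have base: "\<exists>B. Q B" using t by (intro exI[of _ "{}"]) (auto simp: Q_def)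
  define R where "R = (\<lambda>B B'. B \<subseteq> B' \<and> (\<forall>C\<in>sets M. C \<subseteq> A - B \<longrightarrow>
      measure M C \<le> t - measure M B \<longrightarrow> measure M C \<le> 2 * (measure M B' - measure M B)))"
  have "\<exists>B. \<forall>n. Q (B n) \<and> R (B n) (B (Suc n))"
    using step by (intro dependent_nat_choice base) (simp add: R_def)
  then obtain B where B: "\<And>n. Q (B n)" and R: "\<And>n. R (B n) (B (Suc n))" by blast
  have inc: "B n \<subseteq> B (Suc n)"
    and greedy: "\<And>C. C \<in> sets M \<Longrightarrow> C \<subseteq> A - B n \<Longrightarrow> measure M C \<le> t - measure M (B n) \<Longrightarrow>
      measure M C \<le> 2 * (measure M (B (Suc n)) - measure M (B n))" for n
    using R[of n] by (simp_all add: R_def)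
  define U where "U = (\<Union>n. B n)"
  have sets: "B n \<in> sets M" for n using B by (simp add: Q_def)
  have U: "U \<in> sets M" "U \<subseteq> A" using B by (auto simp: U_def Q_def)
  have lim: "(\<lambda>n. measure M (B n)) \<longlonglongrightarrow> measure M U"
    unfolding U_def using sets inc by (intro finite_Lim_measure_incseq) (auto intro: incseq_SucI)
  have le: "measure M U \<le> t"
    using B by (intro LIMSEQ_le_const2[OF lim]) (auto simp: Q_def)
  have "measure M U = t"
  proof (rule ccontr)
    assume "measure M U \<noteq> t"
    then have lt: "0 < t - measure M U" using le by simp
    have "measure M (A - U) = measure M A - measure M U"
      using A U by (intro finite_measure_Diff)
    \<comment> \<open>A small piece outside \<open>U\<close> remains admissible at every stage, so
      every greedy increment is at least half its measure. The increments tend to 0, a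
      contradiction.\<close>
    then obtain C where C: "C \<in> sets M" "C \<subseteq> A - U" "0 < measure M C" "measure M C < t - measure M U"
      using atomless_small_subset[OF atomless, of "A - U" "t - measure M U"] A U lt t by auto
    have "measure M C \<le> 2 * (measure M (B (Suc n)) - measure M (B n))" for n
    proof (rule greedy[OF C(1)])
      show "C \<subseteq> A - B n" using C(2) by (auto simp: U_def)
      have "measure M (B n) \<le> measure M U"
        by (intro finite_measure_mono U) (auto simp: U_def)
      then show "measure M C \<le> t - measure M (B n)" using C(4) by simp
    qed
    moreover have "(\<lambda>n. 2 * (measure M (B (Suc n)) - measure M (B n))) \<longlonglongrightarrow> 2 * (measure M U - measure M U)"
      by (intro tendsto_intros lim LIMSEQ_Suc)
    ultimately have "measure M C \<le> 2 * (measure M U - measure M U)"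
      by (intro LIMSEQ_le_const) auto
    then show False using C(3) by simp
  qed
  then show ?thesis using U by blast
qed

text \<open>To add a set \<open>V\<close> to the family, halve \<open>A \<inter> V\<close> and
  \<open>A - V\<close> separately against the earlier sets; by additivity the union halves
  everything at once.\<close>

lemma atomless_common_halving:
  assumes "atomless M" "finite \<U>" "\<U> \<subseteq> sets M" "A \<in> sets M"
  shows "\<exists>S\<in>sets M. S \<subseteq> A \<and> measure M S = measure M A / 2 \<and>
    (\<forall>U\<in>\<U>. measure M (S \<inter> U) = measure M (A \<inter> U) / 2)"
  using assms(2-4)
proof (induction \<U> arbitrary: A rule: finite_induct)
  case empty
  then show ?case using atomless_subset_of_measure[OF assms(1), of A "measure M A / 2"] by simp
next
  case (insert V \<U>)
  have V: "V \<in> sets M" and \<U>: "\<And>U. U \<in> \<U> \<Longrightarrow> U \<in> sets M" using insert.prems by auto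
  obtain S1 where S1: "S1 \<in> sets M" "S1 \<subseteq> A \<inter> V" "measure M S1 = measure M (A \<inter> V) / 2"
    "\<forall>U\<in>\<U>. measure M (S1 \<inter> U) = measure M (A \<inter> V \<inter> U) / 2"
    using insert.IH[of "A \<inter> V"] insert.prems by auto
  obtain S2 where S2: "S2 \<in> sets M" "S2 \<subseteq> A - V" "measure M S2 = measure M (A - V) / 2"
    "\<forall>U\<in>\<U>. measure M (S2 \<inter> U) = measure M ((A - V) \<inter> U) / 2"
    using insert.IH[of "A - V"] insert.prems by auto
  have split: "measure M (B \<inter> C) = measure M (B \<inter> V \<inter> C) + measure M ((B - V) \<inter> C)"
    if "B \<in> sets M" "C \<in> sets M" for B C
  proof -
    have "measure M ((B \<inter> V \<inter> C) \<union> ((B - V) \<inter> C)) = measure M (B \<inter> V \<inter> C) + measure M ((B - V) \<inter> C)"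
      using that V by (intro finite_measure_Union) auto
    moreover have "(B \<inter> V \<inter> C) \<union> ((B - V) \<inter> C) = B \<inter> C" by auto
    ultimately show ?thesis by simp
  qed
  have V1: "(S1 \<union> S2) \<inter> V = S1" and V2: "(S1 \<union> S2) - V = S2" using S1(2) S2(2) by auto
  have S: "S1 \<union> S2 \<in> sets M" using S1 S2 by auto
  have "measure M ((S1 \<union> S2) \<inter> U) = measure M (A \<inter> U) / 2" if "U \<in> \<U>" for U
    using split[OF S \<U>[OF that]] split[OF insert.prems(2) \<U>[OF that]] S1(4) S2(4) that
    by (simp add: V1 V2 add_divide_distrib)
  moreover have "measure M (S1 \<union> S2) = measure M A / 2"
    using split[OF S sets.top] split[OF insert.prems(2) sets.top] S1 S2 S insert.prems(2) V
    by (simp add: V1 V2 add_divide_distrib sets.Int_space_eq2)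
  ultimately show ?case using S1 S2 V1 by (intro bexI[of _ "S1 \<union> S2"]) auto
qed

text \<open>Choose \<open>S n\<close> to halve \<open>E\<close> and all earlier \<open>S m\<close>,
  and let \<open>r n\<close> be 1 on \<open>S n\<close> and -1 on the rest of \<open>E\<close>. Two
  different sets then meet in a quarter of the measure of \<open>E\<close>, so the four terms in the
  integral of a product cancel.\<close>

lemma ex_rademacher:
  assumes atomless: "atomless M" and E: "E \<in> sets M"
  shows "\<exists>r :: nat \<Rightarrow> 'a \<Rightarrow> real. (\<forall>n. r n \<in> borel_measurable M) \<and> (\<forall>n x. \<bar>r n x\<bar> = indicator E x) \<and>
    (\<forall>m n. m \<noteq> n \<longrightarrow> (\<integral>x. r m x * r n x \<partial>M) = 0)"
proof -
  define H where "H = (\<lambda>\<U> S. S \<in> sets M \<and> S \<subseteq> E \<and> measure M S = measure M E / 2 \<and>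
      (\<forall>U\<in>\<U>. measure M (S \<inter> U) = measure M (E \<inter> U) / 2))"
  have "\<exists>S. H \<U> S" if "finite \<U>" "\<U> \<subseteq> sets M" for \<U>
    using atomless_common_halving[OF atomless that E] by (auto simp: H_def)
  then obtain s where s: "\<And>\<U>. finite \<U> \<Longrightarrow> \<U> \<subseteq> sets M \<Longrightarrow> H \<U> (s \<U>)"
    by metis
  define \<U> where "\<U> = rec_nat {} (\<lambda>_ \<U>. insert (s \<U>) \<U>)"
  have \<U>0: "\<U> 0 = {}" and \<U>S: "\<U> (Suc n) = insert (s (\<U> n)) (\<U> n)" for n by (simp_all add: \<U>_def)
  have \<U>: "finite (\<U> n) \<and> \<U> n \<subseteq> sets M" for n
    by (induction n) (use s in \<open>auto simp: \<U>0 \<U>S H_def\<close>)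
  define S where "S = (\<lambda>n. s (\<U> n))"
  have S_in: "S m \<in> \<U> n" if "m < n" for m n
    using that by (induction n) (auto simp: \<U>S S_def less_Suc_eq)
  have S: "S n \<in> sets M" "S n \<subseteq> E" "measure M (S n) = measure M E / 2" for n
    using s[of "\<U> n"] \<U>[of n] by (auto simp: S_def H_def)
  have S_less: "measure M (S n \<inter> S m) = measure M E / 4" if "m < n" for m n
  proof -
    have "measure M (S n \<inter> S m) = measure M (E \<inter> S m) / 2"
      using s[of "\<U> n"] \<U>[of n] S_in[OF that] by (auto simp: S_def H_def)
    also have "E \<inter> S m = S m" using S(2) by auto
    finally show ?thesis using S(3) by simp
  qed
  have S_neq: "measure M (S m \<inter> S n) = measure M E / 4" if "m \<noteq> n" for m n
    using S_less[of m n] S_less[of n m] that by (auto simp: Int_commute neq_iff)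
  define r where "r = (\<lambda>n x. 2 * indicator (S n) x - indicator E x :: real)"
  have "r n \<in> borel_measurable M" for n using S E by (simp add: r_def)
  moreover have "\<bar>r n x\<bar> = indicator E x" for n x using S(2)[of n] by (auto simp: r_def indicator_def)
  moreover have "(\<integral>x. r m x * r n x \<partial>M) = 0" if "m \<noteq> n" for m n
  proof -
    have "(\<lambda>x. r m x * r n x) = (\<lambda>x. 4 * indicator (S m \<inter> S n) x - 2 * indicator (S m) x
        - 2 * indicator (S n) x + indicator E x)"
      using S(2)[of m] S(2)[of n] by (auto simp: r_def indicator_def fun_eq_iff)
    moreover have "integrable M (indicator B :: 'a \<Rightarrow> real)" if "B \<in> sets M" for B
      using that by (simp add: emeasure_eq_measure)
    ultimately have "(\<integral>x. r m x * r n x \<partial>M)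
        = 4 * measure M (S m \<inter> S n) - 2 * measure M (S m) - 2 * measure M (S n) + measure M E"
      using S E by (simp add: sets.Int)
    then show ?thesis using S_neq[OF that] S(3) by simp
  qed
  ultimately show ?thesis by blast
qed

section \<open>Weak convergence of orthogonal sequences\<close>

lemma orthogonal_weakly_null_bounded:
  fixes r :: "nat \<Rightarrow> 'a \<Rightarrow> real"
  assumes [measurable]: "\<And>n. r n \<in> borel_measurable M" "h \<in> borel_measurable M"
    and r: "\<And>n x. \<bar>r n x\<bar> \<le> 1" and h: "\<And>x. \<bar>h x\<bar> \<le> B"
    and orth: "\<And>m n. m \<noteq> n \<Longrightarrow> (\<integral>x. r m x * r n x \<partial>M) = 0"
  shows "(\<lambda>n. \<integral>x. r n x * h x \<partial>M) \<longlonglongrightarrow> 0"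
proof -
  define c where "c = (\<lambda>n. \<integral>x. r n x * h x \<partial>M)"
  \<comment> \<open>A Bessel inequality without normalization: the square of
    \<open>h - \<tau> * (\<Sum>i<n. c i * r i x)\<close> has nonnegative integral. As each
    \<open>r i\<close> has square integral at most the total mass, \<open>\<tau>\<close> times that
    mass being at most 1 lets the quadratic term absorb only half of the linear one. The added 1
    avoids division by zero.\<close>
  define \<tau> where "\<tau> = 1 / (measure M (space M) + 1)"
  have "0 < measure M (space M) + 1" using measure_nonneg[of M "space M"] by linarith
  then have \<tau>: "0 < \<tau>" "\<tau> * measure M (space M) \<le> 1"
    by (simp_all add: \<tau>_def pos_divide_le_eq)
  have int_rr: "integrable M (\<lambda>x. r m x * r n x)" for m n
    using mult_mono[OF r r] by (intro integrable_const_bound[where B = 1] AE_I2) (auto simp: abs_mult)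
  have int_rh: "integrable M (\<lambda>x. r n x * h x)" for n
    using mult_mono[OF r h] by (intro integrable_const_bound[where B = B] AE_I2) (auto simp: abs_mult)
  have int_hh: "integrable M (\<lambda>x. h x * h x)"
  proof (intro integrable_const_bound[where B = "B * B"] AE_I2)
    show "norm (h x * h x) \<le> B * B" for x
      using mult_mono[OF h h, of x x] order_trans[OF abs_ge_zero h[of x]] by (simp only: real_norm_def abs_mult abs_ge_zero)
  qed measurable
  have "(\<Sum>i<n. (c i)^2) \<le> (\<integral>x. h x * h x \<partial>M) / \<tau>" for n
  proof -
    let ?Q = "\<Sum>i<n. (c i)^2"
    have "(h x - \<tau> * (\<Sum>i<n. c i * r i x))^2 = h x * h x - 2 * \<tau> * (\<Sum>i<n. c i * (r i x * h x))
        + \<tau>^2 * (\<Sum>i<n. \<Sum>j<n. c i * c j * (r i x * r j x))" for x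
      by (simp add: power2_eq_square algebra_simps sum_distrib_left sum_distrib_right)
    then have "0 \<le> (\<integral>x. h x * h x - 2 * \<tau> * (\<Sum>i<n. c i * (r i x * h x))
        + \<tau>^2 * (\<Sum>i<n. \<Sum>j<n. c i * c j * (r i x * r j x)) \<partial>M)"
      by (intro Bochner_Integration.integral_nonneg) (metis zero_le_power2)
    also have "\<dots> = (\<integral>x. h x * h x \<partial>M) - 2 * \<tau> * (\<Sum>i<n. c i * c i)
        + \<tau>^2 * (\<Sum>i<n. \<Sum>j<n. c i * c j * (\<integral>x. r i x * r j x \<partial>M))"
      by (simp add: int_rr int_rh int_hh c_def)
    also have "(\<Sum>i<n. \<Sum>j<n. c i * c j * (\<integral>x. r i x * r j x \<partial>M)) = (\<Sum>i<n. (c i)^2 * (\<integral>x. r i x * r i x \<partial>M))"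
    proof (intro sum.cong refl)
      fix i assume "i \<in> {..<n}"
      then have "(\<Sum>j<n. c i * c j * (\<integral>x. r i x * r j x \<partial>M)) = (\<Sum>j\<in>{i}. c i * c j * (\<integral>x. r i x * r j x \<partial>M))"
        by (intro sum.mono_neutral_right) (auto simp: orth)
      then show "(\<Sum>j<n. c i * c j * (\<integral>x. r i x * r j x \<partial>M)) = (c i)^2 * (\<integral>x. r i x * r i x \<partial>M)"
        by (simp add: power2_eq_square)
    qed
    also have "(\<Sum>i<n. (c i)^2 * (\<integral>x. r i x * r i x \<partial>M)) \<le> (\<Sum>i<n. (c i)^2 * measure M (space M))"
    proof (intro sum_mono mult_left_mono)
      fix i
      have "(\<integral>x. r i x * r i x \<partial>M) \<le> (\<integral>x. 1 \<partial>M)"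
        using abs_le_square_iff[of _ "1::real"] r
        by (intro integral_mono int_rr) (auto simp: power2_eq_square)
      then show "(\<integral>x. r i x * r i x \<partial>M) \<le> measure M (space M)" by simp
    qed simp
    finally have "0 \<le> (\<integral>x. h x * h x \<partial>M) - 2 * \<tau> * ?Q + \<tau>^2 * (?Q * measure M (space M))"
      by (simp add: power2_eq_square[of "c _"] sum_distrib_right mult_left_mono)
    also have "\<tau>^2 * (?Q * measure M (space M)) = (\<tau> * ?Q) * (\<tau> * measure M (space M))"
      by (simp add: power2_eq_square)
    also have "\<dots> \<le> (\<tau> * ?Q) * 1"
      using \<tau> by (intro mult_left_mono mult_nonneg_nonneg sum_nonneg) auto
    finally have "\<tau> * ?Q \<le> (\<integral>x. h x * h x \<partial>M)" by simp
    then show ?thesis using \<tau>(1) by (simp add: field_simps)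
  qed
  then have "summable (\<lambda>i. (c i)^2)"
    by (intro bounded_imp_summable[of _ "(\<integral>x. h x * h x \<partial>M) / \<tau>"])
      (simp_all add: lessThan_Suc_atMost[symmetric] del: sum.lessThan_Suc)
  then have "(\<lambda>i. (c i)^2) \<longlonglongrightarrow> 0" by (rule summable_LIMSEQ_zero)
  then have "c \<longlonglongrightarrow> 0" by simp
  then show ?thesis by (simp add: c_def)
qed

text \<open>Truncating \<open>h\<close> at a height \<open>K\<close> costs little in L^1 by
  dominated convergence, and \<open>\<bar>r n x\<bar> \<le> 1\<close> makes this error uniform in
  \<open>n\<close>; the bounded case handles the rest.\<close>

lemma orthogonal_weakly_null:
  fixes r :: "nat \<Rightarrow> 'a \<Rightarrow> real"
  assumes r_meas [measurable]: "\<And>n. r n \<in> borel_measurable M"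
    and r: "\<And>n x. \<bar>r n x\<bar> \<le> 1" and h: "integrable M h"
    and orth: "\<And>m n. m \<noteq> n \<Longrightarrow> (\<integral>x. r m x * r n x \<partial>M) = 0"
  shows "(\<lambda>n. \<integral>x. r n x * h x \<partial>M) \<longlonglongrightarrow> 0"
proof (rule LIMSEQ_I)
  fix e :: real assume e: "0 < e"
  have h_meas [measurable]: "h \<in> borel_measurable M" using h by simp
  define g where "g = (\<lambda>(K::nat) x. if \<bar>h x\<bar> \<le> real K then h x else 0)"
  have g_meas [measurable]: "g K \<in> borel_measurable M" for K unfolding g_def by measurable
  have g_bound: "\<bar>g K x\<bar> \<le> real K" for K x by (simp add: g_def)
  have "(\<lambda>K. \<integral>x. \<bar>h x - g K x\<bar> \<partial>M) \<longlonglongrightarrow> (\<integral>x. 0 \<partial>M)"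
  proof (rule integral_dominated_convergence[where w = "\<lambda>x. \<bar>h x\<bar>"])
    show "AE x in M. (\<lambda>K. \<bar>h x - g K x\<bar>) \<longlonglongrightarrow> 0"
    proof (rule AE_I2)
      fix x
      obtain K0 :: nat where "\<bar>h x\<bar> \<le> real K0" using real_arch_simple by blast
      then have "\<bar>h x - g K x\<bar> = 0" if "K0 \<le> K" for K using that by (auto simp: g_def)
      then show "(\<lambda>K. \<bar>h x - g K x\<bar>) \<longlonglongrightarrow> 0"
        by (intro tendsto_eventually eventually_sequentiallyI)
    qed
  qed (use h in \<open>auto simp: g_def\<close>)
  then have "\<forall>\<^sub>F K in sequentially. (\<integral>x. \<bar>h x - g K x\<bar> \<partial>M) < e/2"
    using e by (intro order_tendstoD(2)) auto
  then obtain K where K: "(\<integral>x. \<bar>h x - g K x\<bar> \<partial>M) < e/2"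
    using eventually_happens'[OF sequentially_bot] by blast
  have "(\<lambda>n. \<integral>x. r n x * g K x \<partial>M) \<longlonglongrightarrow> 0"
    by (rule orthogonal_weakly_null_bounded[OF r_meas g_meas r g_bound orth])
  from LIMSEQ_D[OF this, of "e/2"]
  obtain n0 where n0: "\<And>n. n0 \<le> n \<Longrightarrow> \<bar>\<integral>x. r n x * g K x \<partial>M\<bar> < e/2"
    using e by auto
  have int_g: "integrable M (g K)"
    using g_bound by (intro integrable_const_bound[where B = "real K"] AE_I2) auto
  have int_r: "integrable M (\<lambda>x. r n x * f x)" if "integrable M f" for f n
    using that r by (intro Bochner_Integration.integrable_bound[OF that])
      (auto intro!: AE_I2 simp: abs_mult mult_left_le_one_le)
  have "norm ((\<integral>x. r n x * h x \<partial>M) - 0) < e" if "n0 \<le> n" for n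
  proof -
    have "(\<integral>x. r n x * h x \<partial>M) = (\<integral>x. r n x * g K x \<partial>M) + (\<integral>x. r n x * (h x - g K x) \<partial>M)"
      using int_r[OF int_g, of n] int_r[OF Bochner_Integration.integrable_diff[OF h int_g], of n]
      by (subst Bochner_Integration.integral_add[symmetric]) (auto simp: algebra_simps)
    moreover have "\<bar>\<integral>x. r n x * (h x - g K x) \<partial>M\<bar> \<le> (\<integral>x. \<bar>h x - g K x\<bar> \<partial>M)"
      using int_r[OF Bochner_Integration.integrable_diff[OF h int_g], of n, THEN integrable_abs] r h int_g
      by (intro order_trans[OF integral_abs_bound] integral_mono) (auto simp: abs_mult intro: mult_left_le_one_le)
    ultimately show ?thesis using n0[OF that] K by simp
  qed
  then show "\<exists>n0. \<forall>n\<ge>n0. norm ((\<integral>x. r n x * h x \<partial>M) - 0) < e" by blast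
qed

end

section \<open>The integrals of the positive and negative parts\<close>

lemma (in unconditional_fun_basis) no_absolute_integral_bound:
  assumes "finite_measure M" and atomless: "atomless M" and E: "E \<in> sets M" "0 < measure M E"
    and X_int: "\<And>f. f \<in> X \<Longrightarrow> integrable M f"
    and bounded_mem: "\<And>f. f \<in> borel_measurable M \<Longrightarrow> (\<exists>C. AE x in M. \<bar>f x\<bar> \<le> C) \<Longrightarrow> f \<in> X"
    and koethe: "koethe_dual_is_dual M X N"
    and abs_bound: "\<And>f. f \<in> X \<Longrightarrow> (LINT x:E|M. \<bar>f x\<bar>) \<le> D * N f"
  shows "\<not> (\<exists>C. \<forall>F c. finite F \<longrightarrow> \<bar>\<Sum>k\<in>F. c k * (LINT x:E|M. \<bar>u k x\<bar>)\<bar> \<le> C * N (comb F c))"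
proof
  interpret finite_measure M by fact
  define b where "b = (\<lambda>k. LINT x:E|M. \<bar>u k x\<bar>)"
  assume "\<exists>C. \<forall>F c. finite F \<longrightarrow> \<bar>\<Sum>k\<in>F. c k * (LINT x:E|M. \<bar>u k x\<bar>)\<bar> \<le> C * N (comb F c)"
  then obtain C where bound: "\<And>F c. finite F \<Longrightarrow> \<bar>\<Sum>k\<in>F. c k * b k\<bar> \<le> C * N (comb F c)"
    unfolding b_def by blast
  have b_nonneg: "0 \<le> b k" for k
    unfolding b_def set_lebesgue_integral_def by (intro Bochner_Integration.integral_nonneg) auto
  obtain K where K: "\<forall>f\<in>X. summable (\<lambda>k. \<bar>coef f k\<bar> * b k) \<and> (\<Sum>k. \<bar>coef f k\<bar> * b k) \<le> K * N f"
    using weighted_coef_summable_bounded[OF b_nonneg bound] ..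
  have set_int: "set_integrable M E (\<lambda>x. \<bar>f x\<bar>)" if "f \<in> X" for f
    unfolding set_integrable_def using X_int[OF that] E(1) by (intro integrable_mult_indicator) auto
  \<comment> \<open>The triangle inequality handles the partial sums of the expansion; by
    \<open>abs_bound\<close> the remainder disappears in the limit.\<close>
  have l1_le: "(LINT x:E|M. \<bar>f x\<bar>) \<le> (\<Sum>k. \<bar>coef f k\<bar> * b k)" if f: "f \<in> X" for f
  proof -
    have "(LINT x:E|M. \<bar>f x\<bar>) \<le> D * N (\<lambda>x. f x - comb {..<n} (coef f) x) + (\<Sum>k. \<bar>coef f k\<bar> * b k)" for n
    proof -
      have rest: "(\<lambda>x. f x - comb {..<n} (coef f) x) \<in> X" by (intro diff f comb_mem)
      have sum_int: "set_integrable M E (\<lambda>x. \<Sum>k<n. \<bar>coef f k\<bar> * \<bar>u k x\<bar>)"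
        unfolding set_integrable_def scaleR_sum_right
        by (intro Bochner_Integration.integrable_sum)
          (rule set_integrable_mult_right[OF set_int[OF u_mem], unfolded set_integrable_def])
      have "\<bar>f x\<bar> \<le> \<bar>f x - comb {..<n} (coef f) x\<bar> + (\<Sum>k<n. \<bar>coef f k\<bar> * \<bar>u k x\<bar>)" for x
        using sum_abs[of "\<lambda>k. coef f k * u k x" "{..<n}"] by (simp add: abs_mult)
      then have "(LINT x:E|M. \<bar>f x\<bar>)
          \<le> (LINT x:E|M. \<bar>f x - comb {..<n} (coef f) x\<bar> + (\<Sum>k<n. \<bar>coef f k\<bar> * \<bar>u k x\<bar>))"
        by (intro set_integral_mono set_int f set_integral_add(1) rest sum_int) auto
      also have "\<dots> = (LINT x:E|M. \<bar>f x - comb {..<n} (coef f) x\<bar>) + (LINT x:E|M. (\<Sum>k<n. \<bar>coef f k\<bar> * \<bar>u k x\<bar>))"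
        by (intro set_integral_add(2) set_int rest sum_int)
      also have "(LINT x:E|M. (\<Sum>k<n. \<bar>coef f k\<bar> * \<bar>u k x\<bar>)) = (\<Sum>k<n. \<bar>coef f k\<bar> * b k)"
        unfolding b_def set_integral_mult_right[symmetric]
        unfolding set_lebesgue_integral_def scaleR_sum_right
        by (intro Bochner_Integration.integral_sum
          set_integrable_mult_right[OF set_int[OF u_mem], unfolded set_integrable_def])
      also have "\<dots> \<le> (\<Sum>k. \<bar>coef f k\<bar> * b k)"
        using K f b_nonneg by (intro sum_le_suminf) auto
      finally show ?thesis using abs_bound[OF rest] by linarith
    qed
    moreover have "(\<lambda>n. D * N (\<lambda>x. f x - comb {..<n} (coef f) x) + (\<Sum>k. \<bar>coef f k\<bar> * b k))
        \<longlonglongrightarrow> D * 0 + (\<Sum>k. \<bar>coef f k\<bar> * b k)"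
      by (intro tendsto_intros coef_tendsto f)
    ultimately show ?thesis by (intro LIMSEQ_le_const) auto
  qed
  obtain r :: "nat \<Rightarrow> 'a \<Rightarrow> real" where r_meas: "\<And>n. r n \<in> borel_measurable M"
    and r_abs: "\<And>n x. \<bar>r n x\<bar> = indicator E x"
    and orth: "\<And>m n. m \<noteq> n \<Longrightarrow> (\<integral>x. r m x * r n x \<partial>M) = 0"
    using ex_rademacher[OF atomless E(1)] by blast
  have r_le: "\<bar>r n x\<bar> \<le> 1" for n x by (simp add: r_abs indicator_def)
  have r_mem: "r n \<in> X" for n using r_meas r_le by (intro bounded_mem exI[of _ 1]) auto
  have one_mem: "(\<lambda>x. 1) \<in> X" by (intro bounded_mem exI[of _ 1]) auto
  \<comment> \<open>The duality represents the functional by a function \<open>h\<close>. Testing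
    with the constant 1, which lies in \<open>X\<close>, shows that \<open>h\<close> is integrable,
    so the orthogonal sequence is null against it.\<close>
  have weak: "(\<lambda>n. \<Sum>k. \<epsilon> k * (coef (r n) k * b k)) \<longlonglongrightarrow> 0" if "\<And>k. \<bar>\<epsilon> k\<bar> \<le> 1" for \<epsilon>
  proof -
    have "bdd_lin_fun X N (\<lambda>f. \<Sum>k. \<epsilon> k * (coef f k * b k))"
      by (rule bdd_lin_fun_weighted_coef[OF b_nonneg bound that])
    then obtain h where h: "\<forall>f\<in>X. integrable M (\<lambda>x. f x * h x)"
        "\<forall>f\<in>X. (\<Sum>k. \<epsilon> k * (coef f k * b k)) = (\<integral>x. f x * h x \<partial>M)"
      using koethe unfolding koethe_dual_is_dual_def by blast
    have "integrable M h" using bspec[OF h(1) one_mem] by simp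
    from orthogonal_weakly_null[OF r_meas r_le this orth]
    show ?thesis by (simp add: bspec[OF h(2) r_mem])
  qed
  have "\<exists>n. (\<Sum>k. \<bar>coef (r n) k * b k\<bar>) < measure M E"
  proof (rule weak_null_imp_small_l1[OF _ weak E(2)])
    show "summable (\<lambda>k. \<bar>coef (r n) k * b k\<bar>)" for n
      using K r_mem[of n] b_nonneg by (simp add: abs_mult)
  qed
  then obtain n where "(\<Sum>k. \<bar>coef (r n) k\<bar> * b k) < measure M E"
    using b_nonneg by (auto simp: abs_mult)
  moreover have "(LINT x:E|M. \<bar>r n x\<bar>) = measure M E"
    using E(1) by (simp add: r_abs set_lebesgue_integral_def indicator_inter_arith[symmetric])
  ultimately show False using l1_le[OF r_mem, of n] by simp
qed

theorem theorem2p6: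
  fixes M :: "'a measure" and X :: "('a \<Rightarrow> real) set" and N :: "('a \<Rightarrow> real) \<Rightarrow> real"
    and u :: "nat \<Rightarrow> 'a \<Rightarrow> real"
  assumes "finite_measure M" and "atomless M"
    and "banach_lattice_fs M X N" and "reflexive_fs X N"
    and "\<And>f. f \<in> borel_measurable M \<Longrightarrow> (\<exists>C. AE x in M. \<bar>f x\<bar> \<le> C) \<Longrightarrow> f \<in> X"
    and "\<And>f. f \<in> X \<Longrightarrow> integrable M f"
    and "koethe_dual_is_dual M X N"
    and "unconditional_basis X N u" and "\<And>k. N (u k) = 1"
    and "E \<in> sets M" and "0 < measure M E"
  shows "(\<lambda>k. LINT x:E|M. max 0 (u k x)) \<notin> coef_dual X N u
       \<and> (\<lambda>k. LINT x:E|M. max 0 (- u k x)) \<notin> coef_dual X N u"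
proof -
  interpret unconditional_fun_basis X N u
    using assms(3,8,9) unfolding banach_lattice_fs_def by unfold_locales blast+
  have abs_mem: "(\<lambda>x. \<bar>f x\<bar>) \<in> X" and mono: "\<And>g. g \<in> X \<Longrightarrow> (AE x in M. \<bar>f x\<bar> \<le> \<bar>g x\<bar>) \<Longrightarrow> N f \<le> N g"
    if "f \<in> X" for f
    using assms(3) that unfolding banach_lattice_fs_def by blast+
  have set_int: "set_integrable M E f" if "f \<in> X" for f
    unfolding set_integrable_def using assms(6)[OF that] assms(10) by (intro integrable_mult_indicator) auto
  \<comment> \<open>The indicator of \<open>E\<close> is in the dual because \<open>X\<close>
    consists of integrable functions. This yields the constant \<open>D\<close>, and the lattice
    norm carries the bound over to \<open>\<bar>f\<bar>\<close>.\<close>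
  have "bdd_lin_fun X N (\<lambda>f. \<integral>x. f x * indicator E x \<partial>M)"
  proof (rule conjunct2[OF assms(7)[unfolded koethe_dual_is_dual_def], rule_format])
    show "integrable M (\<lambda>x. f x * indicator E x)" if "f \<in> X" for f
      using set_int[OF that] by (simp add: set_integrable_def mult.commute)
  qed (use assms(10) in simp)
  then obtain D where "\<forall>f\<in>X. \<bar>\<integral>x. f x * indicator E x \<partial>M\<bar> \<le> D * N f"
    unfolding bdd_lin_fun_def by blast
  then have D: "\<bar>LINT x:E|M. f x\<bar> \<le> D * N f" if "f \<in> X" for f
    using that by (auto simp: set_lebesgue_integral_def mult.commute)
  have abs_bound: "(LINT x:E|M. \<bar>f x\<bar>) \<le> D * N f" if f: "f \<in> X" for f
  proof -
    have "N (\<lambda>x. \<bar>f x\<bar>) = N f" using mono[OF f abs_mem[OF f]] mono[OF abs_mem[OF f] f] by simp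
    then show ?thesis using D[OF abs_mem[OF f]] by simp
  qed
  \<comment> \<open>The sign \<open>s\<close> treats both parts together: \<open>s = -1\<close>
    corresponds to the positive part and \<open>s = 1\<close> to the negative part. Finitely
    supported coefficient sequences suffice to extract the bound that
    \<open>no_absolute_integral_bound\<close> excludes.\<close>
  have not_dual: "d \<notin> coef_dual X N u"
    if d: "\<And>k. (LINT x:E|M. \<bar>u k x\<bar>) = 2 * d k + s * (LINT x:E|M. u k x)" and s: "\<bar>s\<bar> = 1" for d s
  proof
    assume "d \<in> coef_dual X N u"
    then obtain C where C: "\<forall>f\<in>X. \<bar>\<Sum>k. coef f k * d k\<bar> \<le> C * N f"
      unfolding coef_dual_def by blast
    have "\<bar>\<Sum>k\<in>F. c k * (LINT x:E|M. \<bar>u k x\<bar>)\<bar> \<le> (2 * C + D) * N (comb F c)" if F: "finite F" for F c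
    proof -
      have "(\<Sum>k. coef (comb F c) k * d k) = (\<Sum>k\<in>F. c k * d k)"
        using F by (subst suminf_finite[OF F]) (auto simp: coef_comb)
      then have 1: "\<bar>\<Sum>k\<in>F. c k * d k\<bar> \<le> C * N (comb F c)"
        using bspec[OF C comb_mem, of c F] by simp
      have "(LINT x:E|M. comb F c x) = (\<Sum>k\<in>F. c k * (LINT x:E|M. u k x))"
        using set_int[OF u_mem] unfolding set_lebesgue_integral_def set_integrable_def
        by (simp add: sum_distrib_left mult.left_commute)
      then have 2: "\<bar>\<Sum>k\<in>F. c k * (LINT x:E|M. u k x)\<bar> \<le> D * N (comb F c)"
        using D[OF comb_mem, of c F] by simp
      have "(\<Sum>k\<in>F. c k * (LINT x:E|M. \<bar>u k x\<bar>))
          = 2 * (\<Sum>k\<in>F. c k * d k) + s * (\<Sum>k\<in>F. c k * (LINT x:E|M. u k x))"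
        by (simp add: d algebra_simps sum.distrib sum_distrib_left)
      also have "\<bar>\<dots>\<bar> \<le> 2 * \<bar>\<Sum>k\<in>F. c k * d k\<bar> + \<bar>\<Sum>k\<in>F. c k * (LINT x:E|M. u k x)\<bar>"
        using s by (intro order_trans[OF abs_triangle_ineq]) (simp add: abs_mult)
      finally show ?thesis using 1 2 by (simp add: distrib_right)
    qed
    then show False
      using no_absolute_integral_bound[OF assms(1,2,10,11,6,5,7) abs_bound] by blast
  qed
  have part: "(LINT x:E|M. \<bar>f x\<bar>) = 2 * (LINT x:E|M. max 0 (f x)) - (LINT x:E|M. f x)" if f: "f \<in> X" for f
  proof -
    have eq: "max 0 (f x) = (1/2) * (\<bar>f x\<bar> + f x)" for x by (simp add: max_def)
    show ?thesis
      unfolding eq using set_int[OF f] set_int[OF abs_mem[OF f]]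
      by (simp add: set_integral_add add_divide_distrib)
  qed
  have "(LINT x:E|M. - u k x) = - (LINT x:E|M. u k x)" for k
    by (simp add: set_lebesgue_integral_def)
  then show ?thesis
    using not_dual[of "\<lambda>k. LINT x:E|M. max 0 (u k x)" "-1"]
      not_dual[of "\<lambda>k. LINT x:E|M. max 0 (- u k x)" 1]
      part[OF u_mem] part[OF scale[OF u_mem, of "-1"]] by simp
qed

end
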